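(* Let $s,t,r\in\mathbb{N}$ with $s\leqslant rt$ and $r\leqslant st$. Then the set $\mathcal{C}^{\mathrm{e}}_{s,t,r}$ is an open subset of $\mathcal{C}_{s,t,r}$. In particular, $\mathcal{C}^{\mathrm{e}}_{s,t,r}$ is a smooth embedded submanifold of $\mathcal{C}_{s,t,r}$ and of $\mathbb{R}^{2s^2t^2}$, of dimension $2srt-r^2-s^2$. Moreover, $\mathcal{C}^{\mathrm{e}}_{s,t,s}\neq\emptyset$.
   Context: Identify $\mathbb{C}^{st\times st}\cong\mathbb{R}^{2s^2t^2}$. Let $\mathcal{C}_{s,t}$ be the set of (Choi-states) $C_{AB}\in\mathbb{C}^{st\times st}$, $C_{AB}$ positive semi-definite on $\mathbb{C}^s\otimes\mathbb{C}^t$ (system $A$ of dimension $s$, system $B$ of dimension $t$), with $\mathrm{tr}_B\,C_{AB}=\frac{1}{s}I_s$. This is a convex set. Let $\mathcal{C}_{s,t,r}$ be the set of elements of $\mathcal{C}_{s,t}$ of rank $r$, and $\mathcal{C}^{\mathrm{e}}_{s,t,r}$ the set of elements of $\mathcal{C}_{s,t,r}$ that are extreme points of $\mathcal{C}_{s,t}$. The set $\mathcal{C}_{s,t,r}$ is a smooth embedded submanifold of $\mathbb{R}^{2s^2t^2}$ (with the subspace topology). *)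

theory Defs
  imports "HOL-Analysis.Analysis"
begin

text \<open>Matrices on C^s (x) C^t: index type 's \<times> 't; s = CARD('s), t = CARD('t).
  The type complex^('s\<times>'t)^('s\<times>'t) is a Euclidean space of real dimension
  2 s^2 t^2, with the canonical identification (real and imaginary parts of entries).\<close>

type_synonym ('s,'t) cmat = "complex ^ ('s \<times> 't) ^ ('s \<times> 't)"

definition hermitian :: "complex ^ 'n ^ 'n \<Rightarrow> bool" where
  "hermitian C \<longleftrightarrow> (\<forall>i j. C $ i $ j = cnj (C $ j $ i))"

definition psd :: "complex ^ 'n ^ 'n \<Rightarrow> bool" where
  "psd C \<longleftrightarrow> hermitian C \<and>
     (\<forall>x :: complex ^ 'n. 0 \<le> Re (\<Sum>i\<in>UNIV. \<Sum>j\<in>UNIV. cnj (x $ i) * C $ i $ j * x $ j))"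

definition ptrace_B :: "('s::finite, 't::finite) cmat \<Rightarrow> complex ^ 's ^ 's" where
  "ptrace_B C = (\<chi> a a'. \<Sum>b\<in>UNIV. C $ (a, b) $ (a', b))"

definition choi :: "('s::finite, 't::finite) cmat set" where
  "choi = {C. psd C \<and> ptrace_B C = (1 / of_nat CARD('s)) *\<^sub>R mat 1}"

definition choi_rank :: "nat \<Rightarrow> ('s::finite, 't::finite) cmat set" where
  "choi_rank r = {C \<in> choi. rank C = r}"

definition choi_ext :: "nat \<Rightarrow> ('s::finite, 't::finite) cmat set" where
  "choi_ext r = {C \<in> choi_rank r. C extreme_point_of choi}"

coinductive smooth_on :: "'a::euclidean_space set \<Rightarrow> ('a \<Rightarrow> 'b::euclidean_space) \<Rightarrow> bool"
  for U where
  "f differentiable_on U \<Longrightarrow> (\<And>v. smooth_on U (\<lambda>x. frechet_derivative f (at x) v))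
     \<Longrightarrow> smooth_on U f"

definition submanifold_dim :: "'a::euclidean_space set \<Rightarrow> nat \<Rightarrow> bool" where
  "submanifold_dim M d \<longleftrightarrow>
     (\<exists>L::'a set. subspace L \<and> dim L = d) \<and>
     (\<forall>p\<in>M. \<exists>V W (\<phi>::'a \<Rightarrow> 'a) \<psi> L.
        open V \<and> p \<in> V \<and> open W \<and> \<phi> ` V = W \<and> \<psi> ` W = V \<and>
        (\<forall>x\<in>V. \<psi> (\<phi> x) = x) \<and> (\<forall>y\<in>W. \<phi> (\<psi> y) = y) \<and>
        smooth_on V \<phi> \<and> smooth_on W \<psi> \<and>
        subspace L \<and> dim L = d \<and> \<phi> ` (M \<inter> V) = W \<inter> L)"

end

theory Submission
  imports Defs
begin

text \<open>
  Near a positive semidefinite \<open>C\<^sub>0\<close> of rank \<open>r\<close> choose an index set \<open>I\<close> of size \<open>r\<close> whose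
  principal block is positive definite. A nearby Hermitian \<open>C\<close> is then positive semidefinite of rank
  \<open>r\<close> iff its Schur complement with respect to that block vanishes, so nearby the rank-\<open>r\<close> stratum
  is the zero set of \<open>C \<mapsto> (C - C\<^sup>*, Schur complement, partial trace - 1/s)\<close>. This map is a submersion
  onto a space of known dimension: moving \<open>C\<close> along \<open>(1 + \<epsilon> y \<otimes> 1) C (1 + \<epsilon> y \<otimes> 1)\<close> keeps the Schur
  complement zero and changes the partial trace by \<open>2 \<epsilon> y / s\<close>. The inverse function theorem gives the charts.

  \<open>C\<close> fails to be extreme iff there is a Hermitian \<open>H \<noteq> 0\<close> with zero partial trace and
  \<open>ker C \<subseteq> ker H\<close>. On the stratum the kernel condition reads \<open>H = H G(C)\<close> with \<open>G\<close> continuous,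
  so by compactness of the unit sphere it survives limits, and extremality is an open condition.
  An extreme point of rank \<open>s\<close> is the normalised projection onto \<open>\<complex>\<^sup>s \<otimes> b\<close> for a basis vector \<open>b\<close>.
\<close>

subsection \<open>Functions that are differentiable k times\<close>

text \<open>Unlike \<^const>\<open>smooth_on\<close>, this notion admits induction on \<open>k\<close>. For \<open>k = 0\<close> it is void,
  not continuity.\<close>

primrec kdiff_on :: "nat \<Rightarrow> 'a::euclidean_space set \<Rightarrow> ('a \<Rightarrow> 'b::euclidean_space) \<Rightarrow> bool" where
  "kdiff_on 0 U f \<longleftrightarrow> True"
| "kdiff_on (Suc k) U f \<longleftrightarrow>
     f differentiable_on U \<and> (\<forall>v. kdiff_on k U (\<lambda>x. frechet_derivative f (at x) v))"

text \<open>Coinduction: differentiability to every finite order passes to all directional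
  derivatives, so it is an invariant of the kind that \<open>smooth_on\<close> asks for.\<close>

lemma kdiff_on_imp_smooth_on:
  assumes "\<And>k. kdiff_on k U f"
  shows "smooth_on U f"
proof (rule smooth_on.coinduct[where X = "\<lambda>g. \<forall>k. kdiff_on k U g"])
  show "\<forall>k. kdiff_on k U f" using assms by blast
next
  fix g :: "'a \<Rightarrow> 'b" assume g: "\<forall>k. kdiff_on k U g"
  have "g differentiable_on U" using g[rule_format, of "Suc 0"] by simp
  moreover have "kdiff_on k U (\<lambda>x. frechet_derivative g (at x) v)" for k v
    using g[rule_format, of "Suc k"] by simp
  ultimately show "\<exists>f. g = f \<and> f differentiable_on U \<and>
      (\<forall>v. (\<forall>k. kdiff_on k U (\<lambda>x. frechet_derivative f (at x) v)) \<or>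
        smooth_on U (\<lambda>x. frechet_derivative f (at x) v))" by blast
qed

text \<open>Since \<open>U\<close> is open, agreement on \<open>U\<close> is agreement near each of
  its points, so the derivatives agree there too.\<close>

lemma kdiff_on_cong:
  assumes "open U" "kdiff_on k U f" "\<And>x. x \<in> U \<Longrightarrow> f x = g x"
  shows "kdiff_on k U g"
  using assms(2,3)
proof (induction k arbitrary: f g)
  case 0
  then show ?case by simp
next
  case (Suc k)
  have df: "(g has_derivative frechet_derivative f (at x)) (at x)" if "x \<in> U" for x
  proof -
    have "f differentiable (at x)"
      using Suc.prems(1) that assms(1) by (simp add: differentiable_on_eq_differentiable_at)
    then have "(f has_derivative frechet_derivative f (at x)) (at x)"
      by (simp add: frechet_derivative_works)
    then show ?thesis
      by (rule has_derivative_transform_within_open[OF _ assms(1) that Suc.prems(2)])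
  qed
  have eq: "frechet_derivative g (at x) = frechet_derivative f (at x)" if "x \<in> U" for x
    using frechet_derivative_at[OF df[OF that]] by simp
  have "g differentiable_on U"
    using df assms(1) by (auto simp: differentiable_on_eq_differentiable_at differentiable_def)
  moreover have "kdiff_on k U (\<lambda>x. frechet_derivative g (at x) v)" for v
    by (rule Suc.IH[of "\<lambda>x. frechet_derivative f (at x) v"]) (use Suc.prems eq in auto)
  ultimately show ?case by simp
qed

text \<open>Frees the closure rules from \<open>frechet_derivative\<close>: any explicit formula for
  the derivative may be supplied.\<close>

lemma kdiff_on_SucI:
  assumes "open U" "\<And>x. x \<in> U \<Longrightarrow> (f has_derivative f' x) (at x)"
    and "\<And>v. kdiff_on k U (\<lambda>x. f' x v)"
  shows "kdiff_on (Suc k) U f"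
proof -
  have "f differentiable_on U"
    using assms(1,2) by (auto simp: differentiable_on_eq_differentiable_at differentiable_def)
  moreover have "kdiff_on k U (\<lambda>x. frechet_derivative f (at x) v)" for v
    by (rule kdiff_on_cong[OF assms(1) assms(3)[of v]]) (metis assms(2) frechet_derivative_at)
  ultimately show ?thesis by simp
qed

lemma kdiff_on_Suc_has_derivative:
  assumes "open U" "kdiff_on (Suc k) U f" "x \<in> U"
  shows "(f has_derivative frechet_derivative f (at x)) (at x)"
  using assms by (simp add: differentiable_on_eq_differentiable_at frechet_derivative_works)

lemma kdiff_on_SucD: "kdiff_on (Suc k) U f \<Longrightarrow> kdiff_on k U f"
  by (induction k arbitrary: f) simp_all

lemma kdiff_on_subset: "kdiff_on k U f \<Longrightarrow> V \<subseteq> U \<Longrightarrow> kdiff_on k V f"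
  by (induction k arbitrary: f) (auto intro: differentiable_on_subset)

lemma kdiff_on_Suc_imp_continuous_on: "kdiff_on (Suc k) U f \<Longrightarrow> continuous_on U f"
  by (simp add: differentiable_imp_continuous_on)

lemma kdiff_on_const:
  assumes "open U"
  shows "kdiff_on k U (\<lambda>x. c)"
proof (induction k arbitrary: c)
  case (Suc k)
  show ?case
    by (rule kdiff_on_SucI[OF assms, where f' = "\<lambda>x v. 0"]) (auto intro: Suc)
qed simp

lemma kdiff_on_linear:
  assumes "open U" "linear h" "kdiff_on k U f"
  shows "kdiff_on k U (\<lambda>x. h (f x))"
  using assms(3)
proof (induction k arbitrary: f)
  case (Suc k)
  have h: "bounded_linear h" using assms(2) by (simp add: linear_conv_bounded_linear)
  show ?case
  proof (rule kdiff_on_SucI[OF assms(1)])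
    show "((\<lambda>x. h (f x)) has_derivative (\<lambda>v. h (frechet_derivative f (at x) v))) (at x)"
      if "x \<in> U" for x
      by (rule bounded_linear.has_derivative[OF h])
         (rule kdiff_on_Suc_has_derivative[OF assms(1) Suc.prems that])
    show "kdiff_on k U (\<lambda>x. h (frechet_derivative f (at x) v))" for v
      using Suc.IH Suc.prems by simp
  qed
qed simp

lemma kdiff_on_ident:
  assumes "open U"
  shows "kdiff_on k U (\<lambda>x. x)"
proof (cases k)
  case (Suc j)
  show ?thesis unfolding Suc
    by (rule kdiff_on_SucI[OF assms, where f' = "\<lambda>x v. v"]) (auto intro: kdiff_on_const[OF assms])
qed simp

lemma kdiff_on_add:
  assumes "open U" "kdiff_on k U f" "kdiff_on k U g"
  shows "kdiff_on k U (\<lambda>x. f x + g x)"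
  using assms(2,3)
proof (induction k arbitrary: f g)
  case (Suc k)
  show ?case
  proof (rule kdiff_on_SucI[OF assms(1)])
    show "((\<lambda>x. f x + g x) has_derivative
        (\<lambda>v. frechet_derivative f (at x) v + frechet_derivative g (at x) v)) (at x)"
      if "x \<in> U" for x
      by (intro has_derivative_add kdiff_on_Suc_has_derivative[OF assms(1) _ that])
         (rule Suc.prems)+
    show "kdiff_on k U (\<lambda>x. frechet_derivative f (at x) v + frechet_derivative g (at x) v)" for v
      using Suc.IH Suc.prems by simp
  qed
qed simp

lemma kdiff_on_minus:
  assumes "open U" "kdiff_on k U f"
  shows "kdiff_on k U (\<lambda>x. - f x)"
  by (rule kdiff_on_linear[OF assms(1) _ assms(2)]) (simp add: linear_iff)

lemma kdiff_on_diff: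
  assumes "open U" "kdiff_on k U f" "kdiff_on k U g"
  shows "kdiff_on k U (\<lambda>x. f x - g x)"
  using kdiff_on_add[OF assms(1,2) kdiff_on_minus[OF assms(1,3)]] by simp

lemma kdiff_on_sum:
  assumes "open U" "\<And>i. i \<in> I \<Longrightarrow> kdiff_on k U (f i)"
  shows "kdiff_on k U (\<lambda>x. \<Sum>i\<in>I. f i x)"
  using assms(2)
proof (induction I rule: infinite_finite_induct)
  case (insert i I)
  then show ?case by (simp add: kdiff_on_add[OF assms(1)])
qed (simp_all add: kdiff_on_const[OF assms(1)])

lemma kdiff_on_bilinear:
  assumes "open U" "bilinear h" "kdiff_on k U f" "kdiff_on k U g"
  shows "kdiff_on k U (\<lambda>x. h (f x) (g x))"
  using assms(3,4)
proof (induction k arbitrary: f g)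
  case (Suc k)
  have h: "bounded_bilinear h" using assms(2) by (simp add: bilinear_conv_bounded_bilinear)
  show ?case
  proof (rule kdiff_on_SucI[OF assms(1)])
    show "((\<lambda>x. h (f x) (g x)) has_derivative
        (\<lambda>v. h (f x) (frechet_derivative g (at x) v) + h (frechet_derivative f (at x) v) (g x))) (at x)"
      if "x \<in> U" for x
      by (rule bounded_bilinear.FDERIV[OF h])
         (rule kdiff_on_Suc_has_derivative[OF assms(1) _ that] Suc.prems)+
    show "kdiff_on k U (\<lambda>x. h (f x) (frechet_derivative g (at x) v)
        + h (frechet_derivative f (at x) v) (g x))" for v
      using Suc.prems by (intro kdiff_on_add[OF assms(1)] Suc.IH) (simp_all add: kdiff_on_SucD)
  qed
qed simp

lemma bilinear_scaleR: "bilinear (\<lambda>(c::real) x::'a::euclidean_space. c *\<^sub>R x)"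
  by (simp add: bilinear_conv_bounded_bilinear bounded_bilinear_scaleR)

lemma linear_eq_sum_Basis:
  fixes h :: "'a::euclidean_space \<Rightarrow> 'b::real_vector"
  assumes "linear h"
  shows "h v = (\<Sum>b\<in>Basis. (v \<bullet> b) *\<^sub>R h b)"
  by (metis (no_types, lifting) assms euclidean_representation linear_scale linear_sum sum.cong)

text \<open>Expanding the argument over the basis turns a varying operator into a finite sum of
  scalar functions times the functions \<open>A x b\<close>, which keeps operator spaces out of the
  argument.\<close>

lemma kdiff_on_operator_apply:
  assumes U: "open U" and "\<And>x. x \<in> U \<Longrightarrow> linear (A x)"
    and "\<And>v. kdiff_on k U (\<lambda>x. A x v)" and f: "kdiff_on k U f"
  shows "kdiff_on k U (\<lambda>x. A x (f x))"
proof (rule kdiff_on_cong[OF U])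
  show "kdiff_on k U (\<lambda>x. \<Sum>b\<in>Basis. (f x \<bullet> b) *\<^sub>R A x b)"
    by (intro kdiff_on_sum[OF U] kdiff_on_bilinear[OF U bilinear_scaleR] assms(3)
        kdiff_on_linear[OF U _ f]) (simp add: linear_iff inner_left_distrib)
qed (simp add: linear_eq_sum_Basis[OF assms(2), symmetric])

text \<open>By the chain rule the derivative is the operator
  \<open>frechet_derivative g (at (f x))\<close> applied to the derivative of \<open>f\<close>. Its
  values are again derivatives of \<open>g\<close> composed with \<open>f\<close>, which is why
  \<open>g\<close> varies in the induction.\<close>

lemma kdiff_on_compose:
  assumes U: "open U" and V: "open V" and "kdiff_on k V g" "kdiff_on k U f" and fU: "f ` U \<subseteq> V"
  shows "kdiff_on k U (\<lambda>x. g (f x))"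
  using assms(3,4)
proof (induction k arbitrary: g)
  case (Suc k)
  show ?case
  proof (rule kdiff_on_SucI[OF U])
    have dg: "(g has_derivative frechet_derivative g (at (f x))) (at (f x))" if "x \<in> U" for x
      by (rule kdiff_on_Suc_has_derivative[OF V Suc.prems(1)]) (use fU that in auto)
    show "((\<lambda>x. g (f x)) has_derivative
        (\<lambda>v. frechet_derivative g (at (f x)) (frechet_derivative f (at x) v))) (at x)"
      if "x \<in> U" for x
      by (rule has_derivative_compose[OF kdiff_on_Suc_has_derivative[OF U Suc.prems(2) that] dg[OF that]])
    show "kdiff_on k U (\<lambda>x. frechet_derivative g (at (f x)) (frechet_derivative f (at x) v))" for v
    proof (rule kdiff_on_operator_apply[OF U, where A = "\<lambda>x. frechet_derivative g (at (f x))"])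
      show "kdiff_on k U (\<lambda>x. frechet_derivative g (at (f x)) w)" for w
        by (rule Suc.IH[where g = "\<lambda>y. frechet_derivative g (at y) w"])
           (use Suc.prems in \<open>auto simp: kdiff_on_SucD\<close>)
    qed (use Suc.prems has_derivative_linear[OF dg] in auto)
  qed
qed simp

text \<open>Differentiating \<open>A x (B x v) = v\<close> expresses the derivative of
  \<open>B x v\<close> through \<open>B\<close> itself and one derivative of \<open>A\<close>, so
  each order of differentiability passes from \<open>A\<close> to \<open>B\<close>.\<close>

lemma kdiff_on_inverse_operator:
  fixes A B :: "'a::euclidean_space \<Rightarrow> 'c::euclidean_space \<Rightarrow> 'c"
  assumes U: "open U" and A: "\<And>x. x \<in> U \<Longrightarrow> linear (A x)" and B: "\<And>x. x \<in> U \<Longrightarrow> linear (B x)"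
    and AB: "\<And>x v. x \<in> U \<Longrightarrow> A x (B x v) = v" and BA: "\<And>x v. x \<in> U \<Longrightarrow> B x (A x v) = v"
    and kA: "\<And>v. kdiff_on k U (\<lambda>x. A x v)"
  shows "kdiff_on k U (\<lambda>x. B x v)"
  using kA
proof (induction k arbitrary: v)
  case (Suc k)
  have kB: "kdiff_on k U (\<lambda>x. B x v)" for v
    by (rule Suc.IH) (rule kdiff_on_SucD[OF Suc.prems])
  \<comment> \<open>\<open>D x u h\<close> is the derivative of \<open>A x u\<close> in direction
    \<open>h\<close> with \<open>u\<close> held fixed.\<close>
  define D where "D = (\<lambda>x u h. \<Sum>b\<in>Basis. (u \<bullet> b) *\<^sub>R frechet_derivative (\<lambda>x. A x b) (at x) h)"
  \<comment> \<open>\<open>(x, u) \<mapsto> (x, A x u)\<close> has the inverse \<open>(x, v) \<mapsto> (x, B x v)\<close>, whose differentiability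
    comes for free from that of the former.\<close>
  have der: "((\<lambda>x. B x v) has_derivative (\<lambda>h. B x (- D x (B x v) h))) (at x)" if x: "x \<in> U" for x
  proof -
    \<comment> \<open>On \<open>U\<close> the sum equals \<open>A x u\<close>; in expanded form it
      can be differentiated jointly in both arguments, using only the derivatives of the functions
      \<open>A x b\<close>.\<close>
    define \<Theta> where "\<Theta> = (\<lambda>(x, u). (x, \<Sum>b\<in>Basis. (u \<bullet> b) *\<^sub>R A x b))"
    define \<Theta>' where "\<Theta>' = (\<lambda>x u (h, w). (h, \<Sum>b\<in>Basis. (u \<bullet> b) *\<^sub>R frechet_derivative (\<lambda>x. A x b) (at x) h
        + (w \<bullet> b) *\<^sub>R A x b))"
    have \<Theta>_eq: "\<Theta> (y, u) = (y, A y u)" if "y \<in> U" for y u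
      unfolding \<Theta>_def by (simp add: linear_eq_sum_Basis[OF A[OF that], symmetric])
    have d\<Theta>: "(\<Theta> has_derivative \<Theta>' (fst z) (snd z)) (at z)" if "z \<in> U \<times> UNIV" for z
    proof -
      obtain y u where z: "z = (y, u)" by force
      have [derivative_intros]: "((\<lambda>p. A (fst p) b) has_derivative
          (\<lambda>p. frechet_derivative (\<lambda>x. A x b) (at y) (fst p))) (at (y, u))" for b
      proof -
        have "((\<lambda>x. A x b) has_derivative frechet_derivative (\<lambda>x. A x b) (at y)) (at (fst (y, u)))"
          using kdiff_on_Suc_has_derivative[OF U Suc.prems] that z by auto
        from has_derivative_compose[OF has_derivative_fst[OF has_derivative_ident] this]
        show ?thesis by simp
      qed
      show ?thesis
        unfolding \<Theta>_def \<Theta>'_def case_prod_unfold z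
        by (rule derivative_eq_intros refl | simp)+
    qed
    have "((\<lambda>(y, v). (y, B y v)) has_derivative
        (\<lambda>(h, w). (h, B x (w - D x (B x v) h)))) (at (\<Theta> (x, B x v)))"
    proof (rule has_derivative_inverse_on[where S = "U \<times> UNIV" and f' = "\<lambda>z. \<Theta>' (fst z) (snd z)"
          and g' = "\<lambda>z (h, w). (h, B x (w - D x (B x v) h))"
          and g = "\<lambda>(y, v). (y, B y v)" and x = "(x, B x v)"])
      show "open (U \<times> (UNIV::'c set))" using U by (simp add: open_Times)
      show "(case \<Theta> z of (y, v) \<Rightarrow> (y, B y v)) = z" if "z \<in> U \<times> UNIV" for z
        using that by (auto simp: \<Theta>_eq BA)
      have "\<Theta>' x (B x v) (h, B x (w - D x (B x v) h)) = (h, w)" for h w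
      proof -
        have "\<Theta>' x (B x v) (h, B x (w - D x (B x v) h))
            = (h, D x (B x v) h + (\<Sum>b\<in>Basis. (B x (w - D x (B x v) h) \<bullet> b) *\<^sub>R A x b))"
          unfolding \<Theta>'_def D_def by (simp add: sum.distrib)
        then show ?thesis
          by (simp add: linear_eq_sum_Basis[OF A[OF x], symmetric] AB x)
      qed
      then show "\<Theta>' (fst (x, B x v)) (snd (x, B x v)) \<circ> (\<lambda>(h, w). (h, B x (w - D x (B x v) h))) = id"
        by (auto simp: fun_eq_iff)
    qed (use d\<Theta> x in auto)
    then have "((\<lambda>(y, v). (y, B y v)) has_derivative
        (\<lambda>(h, w). (h, B x (w - D x (B x v) h)))) (at (x, v))"
      by (simp add: \<Theta>_eq x AB)
    moreover have "((\<lambda>y. (y, v)) has_derivative (\<lambda>h. (h, 0))) (at x)"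
      by (auto intro!: derivative_eq_intros)
    ultimately have "((\<lambda>y. case (y, v) of (y, v) \<Rightarrow> (y, B y v)) has_derivative
        (\<lambda>h. case (h, 0) of (h, w) \<Rightarrow> (h, B x (w - D x (B x v) h)))) (at x)"
      by (rule has_derivative_compose[rotated])
    from has_derivative_snd[OF this] show ?thesis by simp
  qed
  show ?case
  proof (rule kdiff_on_SucI[OF U der])
    fix h
    have "kdiff_on k U (\<lambda>x. D x (B x v) h)"
      unfolding D_def using Suc.prems
      by (intro kdiff_on_sum[OF U] kdiff_on_bilinear[OF U bilinear_scaleR] kdiff_on_linear[OF U _ kB])
         (auto simp: linear_iff inner_left_distrib)
    then show "kdiff_on k U (\<lambda>x. B x (- D x (B x v) h))"
      by (intro kdiff_on_operator_apply[OF U B kB] kdiff_on_minus[OF U])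
  qed
qed simp

subsection \<open>Charts for level sets\<close>

text \<open>A bootstrap: the derivative of \<open>\<psi>\<close> is the inverse of the derivative of
  \<open>\<phi>\<close> taken at \<open>\<psi> y\<close>. If \<open>\<psi>\<close> has order
  \<open>k\<close>, composition and operator inversion give this derivative order \<open>k\<close>,
  hence \<open>\<psi>\<close> order \<open>Suc k\<close>.\<close>

lemma kdiff_on_inverse:
  fixes \<phi> \<psi> :: "'a::euclidean_space \<Rightarrow> 'a"
  assumes V: "open V" and W: "open W" and \<phi>: "\<And>k. kdiff_on k V \<phi>"
    and d\<psi>: "\<And>y. y \<in> W \<Longrightarrow> (\<psi> has_derivative inv (frechet_derivative \<phi> (at (\<psi> y)))) (at y)"
    and bij: "\<And>y. y \<in> W \<Longrightarrow> bij (frechet_derivative \<phi> (at (\<psi> y)))" and WV: "\<psi> ` W \<subseteq> V"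
  shows "kdiff_on k W \<psi>"
proof (induction k)
  case (Suc k)
  have kD: "kdiff_on k V (\<lambda>x. frechet_derivative \<phi> (at x) v)" for v
    using \<phi>[of "Suc k"] by simp
  show ?case
  proof (rule kdiff_on_SucI[OF W d\<psi>])
    show "kdiff_on k W (\<lambda>y. inv (frechet_derivative \<phi> (at (\<psi> y))) v)" for v
    proof (rule kdiff_on_inverse_operator[OF W, where A = "\<lambda>y. frechet_derivative \<phi> (at (\<psi> y))"
          and B = "\<lambda>y. inv (frechet_derivative \<phi> (at (\<psi> y)))"])
      show "linear (frechet_derivative \<phi> (at (\<psi> y)))" if "y \<in> W" for y
        using kdiff_on_Suc_has_derivative[OF V \<phi>, of "\<psi> y"] WV that
        by (auto simp: has_derivative_linear)
      show "linear (inv (frechet_derivative \<phi> (at (\<psi> y))))" if "y \<in> W" for y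
        using d\<psi>[OF that] by (rule has_derivative_linear)
    qed (use bij kdiff_on_compose[OF W V kD Suc WV] in
      \<open>auto simp: bij_def surj_f_inv_f inv_f_f\<close>)
  qed
qed simp

text \<open>If \<open>z\<close> is the component of \<open>D v\<close> orthogonal to
  \<open>S\<close>, the function \<open>F x \<bullet> z\<close> vanishes near \<open>p\<close>, so
  its derivative \<open>D v \<bullet> z\<close> is zero and \<open>z = 0\<close>.\<close>

lemma has_derivative_into_subspace:
  assumes "(F has_derivative D) (at p)" and S: "subspace S" and V: "open V" "p \<in> V"
    and FS: "F ` V \<subseteq> S"
  shows "D v \<in> (S :: 'b::euclidean_space set)"
proof -
  obtain y z where y: "y \<in> span S" and z: "\<And>w. w \<in> span S \<Longrightarrow> orthogonal z w" and Dv: "D v = y + z"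
    by (rule orthogonal_subspace_decomp_exists[of S "D v"]) blast
  have "((\<lambda>x. F x \<bullet> z) has_derivative (\<lambda>v. D v \<bullet> z)) (at p)"
    by (rule bounded_linear.has_derivative[OF bounded_linear_inner_left assms(1)])
  moreover have "((\<lambda>x. F x \<bullet> z) has_derivative (\<lambda>v. 0)) (at p)"
  proof (rule has_derivative_transform_within_open[OF has_derivative_const V])
    show "0 = F x \<bullet> z" if "x \<in> V" for x
      using z[of "F x"] FS that by (auto simp: orthogonal_def inner_commute span_base)
  qed
  ultimately have "D v \<bullet> z = 0"
    by (metis has_derivative_unique)
  then have "z = 0"
    using z[OF y] by (simp add: Dv orthogonal_def inner_left_distrib inner_commute[of y z])
  then show ?thesis using y Dv S by (simp add: span_eq_iff[THEN iffD2])
qed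

text \<open>Rank-nullity: the orthogonal complement \<open>T\<close> of the kernel is mapped
  isomorphically onto the image.\<close>

lemma dim_linear_image_kernel:
  fixes D :: "'a::euclidean_space \<Rightarrow> 'b::euclidean_space"
  assumes D: "linear D" and S: "D ` UNIV = S"
  shows "dim {x. D x = 0} + dim S = DIM('a)"
proof -
  let ?K = "{x. D x = 0}"
  define T where "T = {x. \<forall>y\<in>?K. orthogonal y x}"
  have subK: "subspace ?K" using D by (rule linear_subspace_kernel)
  have subT: "subspace T" unfolding T_def by (rule subspace_orthogonal_to_vectors)
  have dims: "dim T + dim ?K = DIM('a)"
    using dim_subspace_orthogonal_to_vectors[OF subK subspace_UNIV subset_UNIV]
    unfolding T_def by simp
  have inj: "inj_on D T"
  proof (rule inj_onI)
    fix x y assume xy: "x \<in> T" "y \<in> T" "D x = D y"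
    then have "x - y \<in> ?K" "x - y \<in> T"
      using subspace_diff[OF subT] by (auto simp: linear_diff[OF D])
    then have "orthogonal (x - y) (x - y)" unfolding T_def by blast
    then show "x = y" by (simp add: orthogonal_self)
  qed
  have "D ` T = S"
  proof -
    have "D x \<in> D ` T" for x
    proof -
      obtain y z where yz: "y \<in> span ?K" "\<And>w. w \<in> span ?K \<Longrightarrow> orthogonal z w" "x = y + z"
        by (rule orthogonal_subspace_decomp_exists[of ?K x]) blast
      have "y \<in> ?K" using yz(1) subK by (simp add: span_eq_iff[THEN iffD2])
      moreover have "z \<in> T" unfolding T_def
        by (auto intro!: yz(2) span_base simp: orthogonal_commute[of _ z])
      ultimately show ?thesis using yz(3) by (auto simp: linear_add[OF D])
    qed
    then show ?thesis using S by auto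
  qed
  moreover have "dim (D ` T) = dim T"
    using inj subT by (intro dim_image_eq[OF D]) (simp add: span_eq_iff[THEN iffD2])
  ultimately show ?thesis using dims by simp
qed

text \<open>A regular level set theorem for maps into a subspace: the derivative has to be onto
  \<open>S\<close> only. This admits redundant equations, provided their values stay in
  \<open>S\<close>.\<close>

lemma level_set_chart:
  fixes F :: "'a::euclidean_space \<Rightarrow> 'b::euclidean_space"
  assumes U: "open U" "p \<in> U" and F: "\<And>k. kdiff_on k U F" and S: "subspace S" "F ` U \<subseteq> S"
    and D: "(F has_derivative D) (at p)" "S \<subseteq> range D"
  obtains V W \<phi> \<psi> where "open V" "p \<in> V" "V \<subseteq> U" "open W" "\<phi> ` V = W" "\<psi> ` W = V"
    "\<And>x. x \<in> V \<Longrightarrow> \<psi> (\<phi> x) = x" "\<And>y. y \<in> W \<Longrightarrow> \<phi> (\<psi> y) = y" "smooth_on V \<phi>" "smooth_on W \<psi>"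
    "\<phi> ` {x \<in> V. F x = 0} = W \<inter> {x. D x = 0}" "dim {x. D x = 0} + dim S = DIM('a)"
proof -
  have linD: "linear D" using D(1) by (rule has_derivative_linear)
  have "range D \<subseteq> S"
    using has_derivative_into_subspace[OF D(1) S(1) U S(2)] by auto
  with D(2) have rD: "range D = S" by simp
  obtain J where J: "linear J" "\<forall>y\<in>S. D (J y) = y"
    using linear_exists_right_inverse_on[OF linD subspace_UNIV] rD by auto
  \<comment> \<open>Chosen such that \<open>D \<circ> \<phi> = F\<close> on \<open>U\<close> and \<open>\<phi>\<close> has derivative \<open>id\<close> at \<open>p\<close>.\<close>
  define \<phi> where "\<phi> = (\<lambda>x. (x - p) + J (F x - D (x - p)))"
  have k\<phi>: "kdiff_on k U \<phi>" for k
    unfolding \<phi>_def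
    by (intro kdiff_on_add[OF U(1)] kdiff_on_diff[OF U(1)] kdiff_on_linear[OF U(1) J(1)]
        kdiff_on_linear[OF U(1) linD] F kdiff_on_ident[OF U(1)] kdiff_on_const[OF U(1)])
  have D\<phi>: "D (\<phi> x) = F x" if "x \<in> U" for x
  proof -
    have "F x - D (x - p) \<in> S" using S that rD by (intro subspace_diff) auto
    then show ?thesis unfolding \<phi>_def using J by (simp add: linear_add[OF linD])
  qed
  have d\<phi>: "(\<phi> has_derivative frechet_derivative \<phi> (at x)) (at x)" if "x \<in> U" for x
    by (rule kdiff_on_Suc_has_derivative[OF U(1) k\<phi> that])
  have dp: "(\<phi> has_derivative (\<lambda>v. v + J (D v - D v))) (at p)"
  proof -
    have 1: "((\<lambda>x. x - p) has_derivative (\<lambda>v. v)) (at p)"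
      by (auto intro!: derivative_eq_intros)
    have 2: "((\<lambda>x. D (x - p)) has_derivative D) (at p)"
      by (rule bounded_linear.has_derivative[OF has_derivative_bounded_linear[OF D(1)] 1])
    have 3: "bounded_linear J" using J(1) by (simp add: linear_conv_bounded_linear)
    show ?thesis unfolding \<phi>_def
      by (rule has_derivative_add[OF 1 bounded_linear.has_derivative[OF 3 has_derivative_diff[OF D(1) 2]]])
  qed
  have d\<phi>p: "frechet_derivative \<phi> (at p) = id"
    using frechet_derivative_at[OF dp] by (simp add: fun_eq_iff linear_0[OF J(1)])
  \<comment> \<open>The inverse function theorem asks for a derivative continuous in operator norm;
    in finite dimension continuity of its value on each vector suffices.\<close>
  define f' where "f' x = Blinfun (frechet_derivative \<phi> (at x))" for x
  have f': "blinfun_apply (f' x) = frechet_derivative \<phi> (at x)" if "x \<in> U" for x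
    unfolding f'_def using d\<phi>[OF that]
    by (simp add: bounded_linear_Blinfun_apply has_derivative_bounded_linear)
  have cont: "continuous_on U f'"
  proof (rule continuous_on_blinfun_componentwise)
    show "continuous_on U (\<lambda>x. blinfun_apply (f' x) i)" for i
    proof -
      \<comment> \<open>Order two is used here, because order zero of \<open>kdiff_on\<close> for
        the derivative would not give its continuity.\<close>
      have "continuous_on U (\<lambda>x. frechet_derivative \<phi> (at x) i)"
        using k\<phi>[of "Suc (Suc 0)"] by (simp add: differentiable_imp_continuous_on)
      then show ?thesis by (rule continuous_on_eq) (simp add: f')
    qed
  qed
  have "id_blinfun o\<^sub>L f' p = id_blinfun"
    by (rule blinfun_eqI) (simp add: f' U d\<phi>p)
  then obtain V W \<psi> g' where VW: "open V" "V \<subseteq> U" "p \<in> V" "open W" "homeomorphism V W \<phi> \<psi>"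
    "\<And>y. y \<in> W \<Longrightarrow> (\<psi> has_derivative (g' y)) (at y)"
    "\<And>y. y \<in> W \<Longrightarrow> g' y = inv (blinfun_apply (f' (\<psi> y)))"
    "\<And>y. y \<in> W \<Longrightarrow> bij (blinfun_apply (f' (\<psi> y)))"
    using inverse_function_theorem[OF U(1) _ cont U(2), of \<phi> id_blinfun] d\<phi> f' by metis
  have im: "\<phi> ` V = W" "\<psi> ` W = V" and inv: "\<And>x. x \<in> V \<Longrightarrow> \<psi> (\<phi> x) = x" "\<And>y. y \<in> W \<Longrightarrow> \<phi> (\<psi> y) = y"
    using VW(5) by (auto simp: homeomorphism_def)
  have sm: "smooth_on V \<phi>"
    by (rule kdiff_on_imp_smooth_on) (rule kdiff_on_subset[OF k\<phi> VW(2)])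
  have "kdiff_on k W \<psi>" for k
  proof (rule kdiff_on_inverse[OF VW(1,4) kdiff_on_subset[OF k\<phi> VW(2)]])
    fix y assume y: "y \<in> W"
    then have "\<psi> y \<in> U" using im VW(2) by auto
    then show "(\<psi> has_derivative inv (frechet_derivative \<phi> (at (\<psi> y)))) (at y)"
      "bij (frechet_derivative \<phi> (at (\<psi> y)))"
      using VW(6-8)[OF y] f' by auto
  qed (use im in auto)
  then have sm': "smooth_on W \<psi>" by (rule kdiff_on_imp_smooth_on)
  have lev: "\<phi> ` {x \<in> V. F x = 0} = W \<inter> {x. D x = 0}"
  proof (intro equalityI subsetI)
    fix y assume "y \<in> \<phi> ` {x \<in> V. F x = 0}"
    then show "y \<in> W \<inter> {x. D x = 0}" using im(1) VW(2) D\<phi> by auto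
  next
    fix y assume y: "y \<in> W \<inter> {x. D x = 0}"
    then have "\<psi> y \<in> V" using im(2) by blast
    moreover have "F (\<psi> y) = 0"
      using y calculation VW(2) D\<phi>[of "\<psi> y"] inv(2)[of y] by auto
    ultimately show "y \<in> \<phi> ` {x \<in> V. F x = 0}"
      using inv(2)[of y] y by (metis (mono_tags, lifting) IntD1 image_eqI mem_Collect_eq)
  qed
  show ?thesis
    by (rule that[OF VW(1,3,2,4) im inv sm sm' lev dim_linear_image_kernel[OF linD rD]])
qed

subsection \<open>Hermitian and positive definite matrices\<close>

lemma matrix_add_rdistrib: "(A + B) ** C = A ** C + B ** (C :: 'a::semiring_1^'p^'n)"
  by (vector matrix_matrix_mult_def sum.distrib[symmetric] distrib_right)

lemma matrix_diff_ldistrib: "A ** (B - C) = A ** B - A ** (C :: 'a::ring_1^'p^'n)"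
  by (vector matrix_matrix_mult_def sum_subtractf[symmetric] right_diff_distrib)

lemma matrix_diff_rdistrib: "(A - B) ** C = A ** C - B ** (C :: 'a::ring_1^'p^'n)"
  by (vector matrix_matrix_mult_def sum_subtractf[symmetric] left_diff_distrib)

lemmas matrix_algebra = matrix_add_ldistrib matrix_add_rdistrib matrix_diff_ldistrib
  matrix_diff_rdistrib matrix_mul_assoc

lemma bilinear_matrix_mult: "bilinear (\<lambda>A B :: complex^'n^'n. A ** B)"
  by (simp add: bilinear_def linear_iff matrix_algebra scalar_matrix_assoc matrix_scalar_ac)

lemma scaleR_matrix_vector: "(c *\<^sub>R A) *v x = c *\<^sub>R (A *v (x :: complex^'n))"
  by (simp add: matrix_vector_mult_def vec_eq_iff scaleR_sum_right)

lemma matrix_vector_scaleR: "A *v (c *\<^sub>R x) = c *\<^sub>R (A *v (x :: complex^'n))"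
  by (simp add: matrix_vector_mult_def vec_eq_iff scaleR_sum_right)

lemma bilinear_matrix_vector_mult: "bilinear (\<lambda>(A :: complex^'n^'n) x. A *v x)"
  by (simp add: bilinear_def linear_iff matrix_vector_mult_add_rdistrib matrix_vector_right_distrib
      scaleR_matrix_vector matrix_vector_scaleR)

definition dag :: "complex^'n^'m \<Rightarrow> complex^'m^'n" where
  "dag A = (\<chi> i j. cnj (A $ j $ i))"

lemma dag_dag [simp]: "dag (dag A) = A"
  and dag_add: "dag (A + B) = dag A + dag B"
  and dag_diff: "dag (A - B) = dag A - dag B"
  and dag_minus: "dag (- A) = - dag A"
  and dag_scaleR: "dag (c *\<^sub>R A) = c *\<^sub>R dag A"
  and dag_zero [simp]: "dag 0 = 0"
  by (simp_all add: dag_def vec_eq_iff)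

lemma dag_one [simp]: "dag (mat 1) = (mat 1 :: complex^'n^'n)"
  by (simp add: dag_def mat_def vec_eq_iff)

lemma dag_mult: "dag (A ** B) = dag B ** dag A"
  by (simp add: dag_def matrix_matrix_mult_def vec_eq_iff mult.commute)

lemma linear_dag: "linear (dag :: complex^'n^'n \<Rightarrow> _)"
  by (simp add: linear_iff dag_add dag_scaleR)

lemma hermitian_iff_dag: "hermitian C \<longleftrightarrow> dag C = C"
  unfolding hermitian_def dag_def vec_eq_iff vec_lambda_beta by metis

text \<open>The real inner product on \<open>complex^'n\<close> is the real part of the Hermitian
  one, so the conjugate transpose is the adjoint for it as well.\<close>

lemma inner_matrix_vector: "(x :: complex^'n) \<bullet> (A *v y) = (dag A *v x) \<bullet> y"
proof -
  have "x \<bullet> (A *v y) = (\<Sum>i\<in>UNIV. \<Sum>j\<in>UNIV. x $ i \<bullet> (A $ i $ j * y $ j))"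
    by (simp add: inner_vec_def matrix_vector_mult_def inner_sum_right)
  also have "\<dots> = (\<Sum>j\<in>UNIV. \<Sum>i\<in>UNIV. x $ i \<bullet> (A $ i $ j * y $ j))"
    by (rule sum.swap)
  also have "\<dots> = (\<Sum>j\<in>UNIV. \<Sum>i\<in>UNIV. (cnj (A $ i $ j) * x $ i) \<bullet> y $ j)"
    by (intro sum.cong refl) (simp add: inner_complex_def algebra_simps)
  also have "\<dots> = (dag A *v x) \<bullet> y"
    by (simp add: inner_vec_def matrix_vector_mult_def inner_sum_left dag_def)
  finally show ?thesis .
qed

lemma Re_quadratic_form:
  "Re (\<Sum>i\<in>UNIV. \<Sum>j\<in>UNIV. cnj (x $ i) * C $ i $ j * x $ j) = x \<bullet> (C *v (x :: complex^'n))"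
proof -
  have "x \<bullet> (C *v x) = (\<Sum>i\<in>UNIV. \<Sum>j\<in>UNIV. x $ i \<bullet> (C $ i $ j * x $ j))"
    by (simp add: inner_vec_def matrix_vector_mult_def inner_sum_right)
  then show ?thesis
    by (simp add: inner_complex_def algebra_simps)
qed

lemma psd_iff: "psd C \<longleftrightarrow> dag C = C \<and> (\<forall>x. 0 \<le> x \<bullet> (C *v x))"
  unfolding psd_def hermitian_iff_dag Re_quadratic_form ..

text \<open>With \<open>y = C *v x\<close>, the form at \<open>x + t *\<^sub>R y\<close> is
  \<open>2 * t * (y \<bullet> y)\<close> plus a term quadratic in \<open>t\<close>; for small
  negative \<open>t\<close> it would be negative unless \<open>y = 0\<close>.\<close>

lemma psd_kernel:
  assumes "psd C" "x \<bullet> (C *v x) = 0"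
  shows "C *v x = 0"
proof -
  let ?y = "C *v x"
  have C: "dag C = C" "\<And>x. 0 \<le> x \<bullet> (C *v x)" using assms(1) by (auto simp: psd_iff)
  have "0 \<le> 2 * t * (?y \<bullet> ?y) + t\<^sup>2 * (?y \<bullet> (C *v ?y))" for t
  proof -
    have "x \<bullet> (C *v ?y) = ?y \<bullet> ?y"
      using inner_matrix_vector[of x C ?y] C(1) by simp
    then have "(x + t *\<^sub>R ?y) \<bullet> (C *v (x + t *\<^sub>R ?y)) = 2 * t * (?y \<bullet> ?y) + t\<^sup>2 * (?y \<bullet> (C *v ?y))"
      using assms(2)
      by (simp add: vec.add matrix_vector_scaleR inner_simps power2_eq_square algebra_simps)
    then show ?thesis using C(2) by metis
  qed
  then have *: "0 \<le> 2 * t * (?y \<bullet> ?y) + t\<^sup>2 * (?y \<bullet> (C *v ?y))" for t by blast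
  show ?thesis
  proof (rule ccontr)
    assume "?y \<noteq> 0"
    then have p: "?y \<bullet> ?y > 0" by simp
    define q where "q = ?y \<bullet> (C *v ?y)"
    have q: "q \<ge> 0" unfolding q_def by (rule C(2))
    \<comment> \<open>The summand 1 keeps the denominator positive when
      \<open>q = 0\<close>.\<close>
    define t where "t = - (?y \<bullet> ?y) / (q + 1)"
    have "t < 0" unfolding t_def using p q by (simp add: divide_neg_pos)
    moreover have "2 * (?y \<bullet> ?y) + t * q > 0"
    proof -
      have "(?y \<bullet> ?y) * q < (?y \<bullet> ?y) * (2 * (q + 1))" using p q by (intro mult_strict_left_mono) auto
      then show ?thesis unfolding t_def using q by (simp add: field_simps)
    qed
    ultimately have "t * (2 * (?y \<bullet> ?y) + t * q) < 0" by (rule mult_neg_pos)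
    then show False using *[of t] by (simp add: q_def algebra_simps power2_eq_square)
  qed
qed

text \<open>Only the real part of the form is constrained, so this is an open condition on all
  matrices, not merely on Hermitian ones.\<close>

definition posdef :: "complex^'n^'n \<Rightarrow> bool" where
  "posdef N \<longleftrightarrow> (\<forall>x. x \<noteq> 0 \<longrightarrow> 0 < x \<bullet> (N *v x))"

text \<open>The form has a positive minimum \<open>m\<close> on the compact unit sphere, and a
  perturbation of norm below \<open>m / K\<close> changes its values there by less than
  \<open>m\<close>.\<close>

lemma open_posdef: "open {N :: complex^'n^'n. posdef N}"
proof (rule openI)
  fix N :: "complex^'n^'n" assume "N \<in> {N. posdef N}"
  then have N: "posdef N" by simp
  obtain K where K: "\<And>(A :: complex^'n^'n) x. norm (A *v x) \<le> norm A * norm x * K" "K > 0"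
    using bounded_bilinear.pos_bounded[OF bilinear_matrix_vector_mult[unfolded bilinear_conv_bounded_bilinear]]
    by metis
  have cont: "continuous_on (sphere 0 1) (\<lambda>x :: complex^'n. x \<bullet> (N *v x))"
    using bilinear_matrix_vector_mult[where 'n='n]
    by (intro continuous_on_inner continuous_on_id linear_continuous_on)
       (auto simp: bilinear_def linear_conv_bounded_linear)
  have "sphere (0 :: complex^'n) 1 \<noteq> {}" by simp
  from continuous_attains_inf[OF compact_sphere this cont]
  obtain x0 where x0: "x0 \<in> sphere 0 1" "\<And>x. x \<in> sphere 0 1 \<Longrightarrow> x0 \<bullet> (N *v x0) \<le> x \<bullet> (N *v x)"
    by blast
  define m where "m = x0 \<bullet> (N *v x0)"
  have "x0 \<noteq> 0" using x0(1) by auto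
  then have m: "m > 0" using N unfolding m_def posdef_def by blast
  have "ball N (m / K) \<subseteq> {N. posdef N}"
  proof
    fix A assume "A \<in> ball N (m / K)"
    then have A: "norm (A - N) * K < m"
      using K(2) by (simp add: dist_norm norm_minus_commute pos_less_divide_eq)
    have pos: "0 < x \<bullet> (A *v x)" if "norm x = 1" for x
    proof -
      have "\<bar>x \<bullet> ((A - N) *v x)\<bar> \<le> norm x * norm ((A - N) *v x)" by (rule Cauchy_Schwarz_ineq2)
      also have "\<dots> \<le> norm (A - N) * K" using K(1)[of "A - N" x] that by simp
      finally have "\<bar>x \<bullet> ((A - N) *v x)\<bar> < m" using A by simp
      moreover have "m \<le> x \<bullet> (N *v x)" unfolding m_def using x0(2)[of x] that by simp
      moreover have "A *v x = N *v x + (A - N) *v x"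
        by (simp add: matrix_vector_mult_add_rdistrib[symmetric])
      ultimately show ?thesis by (simp add: inner_right_distrib)
    qed
    have "0 < x \<bullet> (A *v x)" if "x \<noteq> 0" for x
    proof -
      have "0 < (x /\<^sub>R norm x) \<bullet> (A *v (x /\<^sub>R norm x))" by (rule pos) (use that in simp)
      also have "\<dots> = (x \<bullet> (A *v x)) / (norm x)\<^sup>2"
        by (simp add: matrix_vector_scaleR power2_eq_square divide_inverse)
      finally show ?thesis using that by (simp add: zero_less_divide_iff)
    qed
    then show "A \<in> {N. posdef N}" by (simp add: posdef_def)
  qed
  then show "\<exists>e>0. ball N e \<subseteq> {N. posdef N}" using m K(2) by (intro exI[of _ "m / K"]) auto
qed

lemma posdef_matrix_inv:
  assumes "posdef N"
  shows "N ** matrix_inv N = mat 1" "matrix_inv N ** N = mat 1"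
proof -
  have "\<forall>x. N *v x = 0 \<longrightarrow> x = 0" using assms by (auto simp: posdef_def)
  then obtain B where "B ** N = mat 1" using matrix_left_invertible_ker by blast
  then have "\<exists>A'. N ** A' = mat 1 \<and> A' ** N = mat 1" using matrix_left_right_inverse by blast
  then have "N ** matrix_inv N = mat 1 \<and> matrix_inv N ** N = mat 1"
    unfolding matrix_inv_def by (rule someI_ex)
  then show "N ** matrix_inv N = mat 1" "matrix_inv N ** N = mat 1" by auto
qed

subsection \<open>Pivot blocks and Schur complements\<close>

text \<open>Blocks are cut out by coordinate projections instead of smaller matrices, so the index
  type is the same for every \<open>I\<close>.\<close>

definition cproj :: "'n set \<Rightarrow> complex^'n^'n" where
  "cproj I = (\<chi> i j. if i = j \<and> i \<in> I then 1 else 0)"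

lemma cproj_mult: "cproj I ** A = (\<chi> i j. if i \<in> I then A $ i $ j else 0)"
proof -
  have "(\<Sum>k\<in>UNIV. (if i = k \<and> i \<in> I then 1 else 0) * A $ k $ j) = (if i \<in> I then A $ i $ j else 0)" for i j
    by (cases "i \<in> I") (simp_all add: if_distribR if_distrib cong: if_cong)
  then show ?thesis by (simp add: vec_eq_iff matrix_matrix_mult_def cproj_def)
qed

lemma mult_cproj: "A ** cproj I = (\<chi> i j. if j \<in> I then A $ i $ j else 0)"
proof -
  have "(\<Sum>k\<in>UNIV. A $ i $ k * (if k = j \<and> k \<in> I then 1 else 0)) = (if j \<in> I then A $ i $ j else 0)" for i j
  proof -
    have "(\<Sum>k\<in>UNIV. A $ i $ k * (if k = j \<and> k \<in> I then 1 else 0))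
        = (\<Sum>k\<in>UNIV. if k = j then (if j \<in> I then A $ i $ j else 0) else 0)"
      by (intro sum.cong) auto
    then show ?thesis by simp
  qed
  then show ?thesis by (simp add: vec_eq_iff matrix_matrix_mult_def cproj_def)
qed

lemma cproj_vector: "cproj I *v x = (\<chi> i. if i \<in> I then x $ i else 0)"
proof -
  have "(\<Sum>k\<in>UNIV. (if i = k \<and> i \<in> I then 1 else 0) * x $ k) = (if i \<in> I then x $ i else 0)" for i
    by (cases "i \<in> I") (simp_all add: if_distribR if_distrib cong: if_cong)
  then show ?thesis by (simp add: vec_eq_iff matrix_vector_mult_def cproj_def)
qed

lemma dag_cproj [simp]: "dag (cproj I) = cproj I"
  by (auto simp: dag_def cproj_def vec_eq_iff)

lemma cproj_idem [simp]: "cproj I ** cproj I = cproj I"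
  by (subst cproj_mult) (simp add: cproj_def vec_eq_iff)

lemma mult_cproj_cproj [simp]: "A ** cproj I ** cproj I = A ** cproj I"
  by (simp add: matrix_mul_assoc[symmetric])

text \<open>The principal \<open>I\<close>-block of \<open>C\<close>, padded by the identity outside \<open>I\<close> so that it can be
  inverted as a full-size matrix.\<close>

definition piv :: "'n set \<Rightarrow> complex^'n^'n \<Rightarrow> complex^'n^'n" where
  "piv I C = cproj I ** C ** cproj I + (mat 1 - cproj I)"

text \<open>A full-size form of the Schur complement: for an invertible pivot the rows and columns
  in \<open>I\<close> vanish and the remaining block is the usual complement.\<close>

definition schur :: "'n set \<Rightarrow> complex^'n^'n \<Rightarrow> complex^'n^'n" where
  "schur I C = C - C ** cproj I ** matrix_inv (piv I C) ** cproj I ** C"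

lemma cproj_piv: "cproj I ** piv I C = cproj I ** C ** cproj I"
  and piv_cproj: "piv I C ** cproj I = cproj I ** C ** cproj I"
  by (simp_all add: piv_def matrix_algebra)

lemma dag_piv: "dag C = C \<Longrightarrow> dag (piv I C) = piv I C"
  by (simp add: piv_def dag_add dag_diff dag_mult matrix_mul_assoc)

lemma dag_matrix_inv:
  assumes "posdef N" "dag N = N"
  shows "dag (matrix_inv N) = matrix_inv N"
proof -
  have "dag (matrix_inv N) ** N = mat 1"
    using arg_cong[OF posdef_matrix_inv(1)[OF assms(1)], of dag] assms(2) by (simp add: dag_mult)
  then have "dag (matrix_inv N) ** N ** matrix_inv N = matrix_inv N" by simp
  then show ?thesis by (simp add: matrix_mul_assoc[symmetric] posdef_matrix_inv(1)[OF assms(1)])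
qed

lemma cproj_matrix_inv_piv:
  assumes "posdef (piv I C)"
  shows "cproj I ** matrix_inv (piv I C) = matrix_inv (piv I C) ** cproj I"
proof -
  let ?K = "matrix_inv (piv I C)" and ?P = "cproj I"
  note K = posdef_matrix_inv[OF assms]
  have "?P ** ?K = ?K ** piv I C ** ?P ** ?K" by (simp add: K)
  also have "\<dots> = ?K ** (piv I C ** ?P) ** ?K" by (simp add: matrix_mul_assoc)
  also have "\<dots> = ?K ** (?P ** piv I C) ** ?K" by (simp only: cproj_piv piv_cproj)
  also have "\<dots> = ?K ** ?P ** (piv I C ** ?K)" by (simp add: matrix_mul_assoc)
  finally show ?thesis by (simp add: K)
qed

text \<open>The pivot cancels against its inverse. Thus the Schur complement lives off
  \<open>I\<close>, which limits the number of equations it imposes.\<close>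

lemma cproj_schur:
  assumes "posdef (piv I C)"
  shows "cproj I ** schur I C = 0"
proof -
  let ?K = "matrix_inv (piv I C)" and ?P = "cproj I"
  have "?P ** (C ** ?P ** ?K ** ?P ** C) = (?P ** C ** ?P) ** ?K ** ?P ** C"
    by (simp add: matrix_mul_assoc)
  also have "\<dots> = ?P ** (piv I C ** ?K) ** ?P ** C"
    by (simp only: cproj_piv[symmetric] matrix_mul_assoc)
  also have "\<dots> = ?P ** C" by (simp add: posdef_matrix_inv[OF assms])
  finally show ?thesis by (simp add: schur_def matrix_diff_ldistrib)
qed

lemma dag_schur:
  assumes "posdef (piv I C)" "dag C = C"
  shows "dag (schur I C) = schur I C"
  using dag_matrix_inv[OF assms(1) dag_piv[OF assms(2)]] assms(2)
  by (simp add: schur_def dag_diff dag_mult matrix_mul_assoc)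

text \<open>The right-hand side says that the rows in \<open>I\<close> span all rows. Such an
  \<open>X\<close> is unique on \<open>I\<close>: restricting the equation to the columns in
  \<open>I\<close> and inverting the pivot gives
  \<open>X ** cproj I = C ** cproj I ** matrix_inv (piv I C)\<close>.\<close>

lemma schur_eq_0_iff:
  assumes "posdef (piv I C)"
  shows "schur I C = 0 \<longleftrightarrow> (\<exists>X. C = X ** cproj I ** C)"
proof
  assume "schur I C = 0"
  then have "C = (C ** cproj I ** matrix_inv (piv I C)) ** cproj I ** C" by (simp add: schur_def)
  then show "\<exists>X. C = X ** cproj I ** C" by blast
next
  let ?K = "matrix_inv (piv I C)" and ?P = "cproj I"
  assume "\<exists>X. C = X ** cproj I ** C"
  then obtain X where X: "C = X ** ?P ** C" by blast
  have "C ** ?P = X ** (?P ** C ** ?P)" by (subst X) (simp add: matrix_mul_assoc)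
  also have "\<dots> = X ** ?P ** piv I C" by (simp only: cproj_piv[symmetric] matrix_mul_assoc)
  finally have "C ** ?P ** ?K = X ** ?P ** (piv I C ** ?K)" by (simp add: matrix_mul_assoc)
  then have "C ** ?P ** ?K ** ?P ** C = C"
    by (simp add: posdef_matrix_inv[OF assms] X[symmetric])
  then show "schur I C = 0" by (simp add: schur_def)
qed

text \<open>The first identity is a congruence with a positive definite matrix. By the second,
  \<open>C\<close> and \<open>G\<close> have the same kernel, so \<open>H ** G = H\<close> expresses
  that \<open>H\<close> vanishes on the kernel of \<open>C\<close>.\<close>

lemma schur_eq_0_factor:
  assumes "posdef (piv I C)" "dag C = C" "schur I C = 0"
  defines "G \<equiv> matrix_inv (piv I C) ** cproj I ** C"
  shows "C = dag G ** piv I C ** G" "C ** G = C" "cproj I ** G = G"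
proof -
  let ?K = "matrix_inv (piv I C)" and ?P = "cproj I"
  note K = posdef_matrix_inv[OF assms(1)] and PK = cproj_matrix_inv_piv[OF assms(1)]
  have C: "C ** ?P ** ?K ** ?P ** C = C" using assms(3) by (simp add: schur_def)
  have dG: "dag G = C ** ?P ** ?K"
    unfolding G_def
    by (simp add: dag_mult assms(2) dag_matrix_inv[OF assms(1) dag_piv[OF assms(2)]] matrix_mul_assoc)
  have "dag G ** piv I C ** G = C ** ?P ** (?K ** piv I C) ** ?K ** ?P ** C"
    unfolding dG by (simp add: G_def matrix_mul_assoc)
  then show "C = dag G ** piv I C ** G" by (simp add: K C)
  show PG: "?P ** G = G"
    unfolding G_def matrix_mul_assoc PK by simp
  have "C ** G = C ** (?P ** G)" by (simp add: PG)
  also have "\<dots> = C" unfolding G_def by (simp add: matrix_mul_assoc C)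
  finally show "C ** G = C" .
qed

section \<open>Rank and positivity in terms of pivot blocks\<close>

lemma rank_eq_dim_range: "rank C = vec.dim (range (($) C))" for C :: "'a::field^'n^'m"
proof -
  have "rows C = range (($) C)" by (auto simp: rows_def row_def)
  then show ?thesis by (simp add: row_rank_def_gen)
qed

text \<open>A vanishing combination of the rows in \<open>I\<close> yields a vector \<open>x\<close>
  supported on \<open>I\<close> with \<open>dag C *v x = 0\<close>, and the form of the pivot is
  zero at \<open>x\<close>.\<close>

lemma piv_rows_independent:
  assumes "posdef (piv I C)"
  shows "inj_on (($) C) I" "vec.independent (($) C ` I)"
proof -
  have L: "\<forall>i\<in>I. c i = 0" if c: "(\<Sum>i\<in>I. c i *s C $ i) = 0" for c
  proof -
    define x where "x = (\<chi> i. if i \<in> I then cnj (c i) else 0)"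
    have "(dag C *v x) $ j = cnj ((\<Sum>i\<in>I. c i *s C $ i) $ j)" for j
    proof -
      have "(dag C *v x) $ j = (\<Sum>i\<in>UNIV. if i \<in> I then cnj (c i * C $ i $ j) else 0)"
        unfolding matrix_vector_mult_def dag_def x_def by (auto intro!: sum.cong)
      then show ?thesis by (simp add: sum.If_cases)
    qed
    then have 0: "dag C *v x = 0" using c by (simp add: vec_eq_iff)
    have Px: "cproj I *v x = x" by (simp add: cproj_vector x_def vec_eq_iff)
    have "x \<bullet> (piv I C *v x) = x \<bullet> (cproj I *v (C *v x))"
      by (simp add: piv_def matrix_vector_mult_add_rdistrib matrix_vector_mult_diff_rdistrib Px
          matrix_vector_mul_assoc[symmetric])
    also have "\<dots> = 0" by (simp add: inner_matrix_vector Px 0)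
    finally have "x = 0" using assms by (force simp: posdef_def)
    then show ?thesis by (auto simp: x_def vec_eq_iff split: if_splits)
  qed
  show inj: "inj_on (($) C) I"
  proof (rule inj_onI, rule ccontr)
    fix i j assume ij: "i \<in> I" "j \<in> I" "C $ i = C $ j" "i \<noteq> j"
    \<comment> \<open>Independence of the image set cannot detect a repeated row, so coefficients 1
      and -1 on the two indices exclude it.\<close>
    let ?c = "\<lambda>k. if k = i then 1 else if k = j then -1 else (0 :: complex)"
    have "(\<Sum>k\<in>I. ?c k *s C $ k) = (\<Sum>k\<in>I. (if k = i then C $ i else 0) - (if k = j then C $ j else 0))"
      using ij(4) by (intro sum.cong) auto
    also have "\<dots> = 0" using ij by (simp add: sum_subtractf)
    finally show False using L[of ?c] ij(1) by auto
  qed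
  show "vec.independent (($) C ` I)"
    using inj by (auto simp: vec.dependent_finite sum.reindex dest!: L[of "\<lambda>i. u (C $ i)" for u])
qed

lemma range_in_span_iff:
  fixes C :: "complex^'n^'n"
  shows "range (($) C) \<subseteq> vec.span (($) C ` I) \<longleftrightarrow> (\<exists>X. C = X ** cproj I ** C)"
proof
  assume sub: "range (($) C) \<subseteq> vec.span (($) C ` I)"
  have "\<exists>c. C $ k = (\<Sum>i\<in>I. c i *s C $ i)" for k
  proof -
    \<comment> \<open>Rows with different indices in \<open>I\<close> may coincide; \<open>J\<close>
      keeps one index for each distinct row.\<close>
    obtain J where J: "J \<subseteq> I" "inj_on (($) C) J" "($) C ` I = ($) C ` J"
      using subset_image_inj[of "($) C ` I" "($) C" I] by auto
    have "C $ k \<in> vec.span (($) C ` J)" using sub J(3) by auto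
    then obtain u where "C $ k = (\<Sum>v\<in>($) C ` J. u v *s v)"
      by (auto simp: vec.span_finite)
    also have "\<dots> = (\<Sum>i\<in>J. u (C $ i) *s C $ i)" by (simp add: sum.reindex[OF J(2)])
    also have "\<dots> = (\<Sum>i\<in>I. (if i \<in> J then u (C $ i) else 0) *s C $ i)"
      using J(1) by (intro sum.mono_neutral_cong_left) auto
    finally show ?thesis by (intro exI[of _ "\<lambda>i. if i \<in> J then u (C $ i) else 0"])
  qed
  then obtain c where c: "\<And>k. C $ k = (\<Sum>i\<in>I. c k i *s C $ i)" by metis
  have "C = (\<chi> k i. c k i) ** cproj I ** C"
  proof -
    have 1: "C $ k $ j = (\<Sum>i\<in>UNIV. (if i \<in> I then c k i else 0) * C $ i $ j)" for k j
    proof -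
      have "C $ k $ j = (\<Sum>i\<in>I. c k i * C $ i $ j)"
        using arg_cong[OF c[of k], of "\<lambda>v. v $ j"] by simp
      also have "\<dots> = (\<Sum>i\<in>UNIV. (if i \<in> I then c k i else 0) * C $ i $ j)"
        by (intro sum.mono_neutral_cong_left) auto
      finally show ?thesis .
    qed
    have 2: "((\<chi> k i. c k i) ** cproj I ** C) $ k $ j
        = (\<Sum>i\<in>UNIV. (if i \<in> I then c k i else 0) * C $ i $ j)" for k j
      by (subst mult_cproj) (simp add: matrix_matrix_mult_def cong: if_cong)
    show ?thesis
      by (intro vec_eq_iff[THEN iffD2] allI) (rule trans[OF 1 2[symmetric]])
  qed
  then show "\<exists>X. C = X ** cproj I ** C" by blast
next
  assume "\<exists>X. C = X ** cproj I ** C"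
  then obtain X where X: "C = X ** cproj I ** C" by blast
  show "range (($) C) \<subseteq> vec.span (($) C ` I)"
  proof clarify
    fix k
    have "C $ k = (\<Sum>i\<in>I. X $ k $ i *s C $ i)"
    proof -
      have 1: "(X ** cproj I ** C) $ k $ j = (\<Sum>i\<in>I. X $ k $ i * C $ i $ j)" for j
        unfolding mult_cproj unfolding matrix_matrix_mult_def vec_lambda_beta
        by (intro sum.mono_neutral_cong_right) auto
      have "C $ k $ j = (\<Sum>i\<in>I. X $ k $ i * C $ i $ j)" for j
        by (rule trans[OF arg_cong[OF X, of "\<lambda>A. A $ k $ j"] 1])
      then show ?thesis unfolding vec_eq_iff by simp
    qed
    also have "\<dots> \<in> vec.span (($) C ` I)"
      by (intro vec.span_sum vec.span_scale vec.span_base) auto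
    finally show "C $ k \<in> vec.span (($) C ` I)" .
  qed
qed

lemma rank_eq_card_iff:
  assumes "posdef (piv I C)"
  shows "rank C = card I \<longleftrightarrow> schur I C = 0"
proof -
  note ind = piv_rows_independent[OF assms]
  have card: "card (($) C ` I) = card I" using ind(1) by (rule card_image)
  have "rank C = card I \<longleftrightarrow> range (($) C) \<subseteq> vec.span (($) C ` I)"
  proof
    assume "rank C = card I"
    then show "range (($) C) \<subseteq> vec.span (($) C ` I)"
      using card ind(2) by (intro vec.card_ge_dim_independent) (auto simp: rank_eq_dim_range)
  next
    assume "range (($) C) \<subseteq> vec.span (($) C ` I)"
    then show "rank C = card I"
      unfolding rank_eq_dim_range using card ind(2) by (intro vec.dim_unique) auto
  qed
  then show ?thesis by (simp add: range_in_span_iff schur_eq_0_iff[OF assms])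
qed

text \<open>Positivity comes for free: if the Schur complement vanishes, \<open>C\<close> is
  congruent to its positive definite pivot. An inequality and a rank condition thereby become one
  equation.\<close>

lemma rank_psd_iff_schur:
  assumes "posdef (piv I C)" "dag C = C"
  shows "psd C \<and> rank C = card I \<longleftrightarrow> schur I C = 0"
proof -
  have "psd C" if "schur I C = 0"
  proof -
    define G where "G = matrix_inv (piv I C) ** cproj I ** C"
    have C: "C = dag G ** piv I C ** G"
      using schur_eq_0_factor(1)[OF assms that] by (simp add: G_def)
    have "x \<bullet> (C *v x) = (G *v x) \<bullet> (piv I C *v (G *v x))" for x
    proof -
      have "C *v x = dag G *v (piv I C *v (G *v x))"
        using arg_cong[OF C, of "\<lambda>A. A *v x"] by (simp only: matrix_vector_mul_assoc matrix_mul_assoc)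
      then show ?thesis using inner_matrix_vector[of x "dag G"] by simp
    qed
    moreover have "0 \<le> y \<bullet> (piv I C *v y)" for y
      using assms(1) by (cases "y = 0") (auto simp: posdef_def less_imp_le)
    ultimately show ?thesis using assms(2) by (simp add: psd_iff)
  qed
  then show ?thesis using rank_eq_card_iff[OF assms(1)] by blast
qed

text \<open>The form splits into that of \<open>C\<close> on the coordinates in \<open>I\<close> and
  the squared norm of the other coordinates.\<close>

lemma inner_piv:
  "x \<bullet> (piv I C *v x) = (cproj I *v x) \<bullet> (C *v (cproj I *v x)) + (x - cproj I *v x) \<bullet> (x - cproj I *v x)"
proof -
  define p where "p = cproj I *v x"
  have "piv I C *v x = cproj I *v (C *v p) + (x - p)"
    unfolding p_def
    by (simp add: piv_def matrix_vector_mult_add_rdistrib matrix_vector_mult_diff_rdistrib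
        matrix_vector_mul_assoc matrix_mul_assoc)
  then have "x \<bullet> (piv I C *v x) = x \<bullet> (cproj I *v (C *v p)) + x \<bullet> (x - p)"
    by (simp add: inner_right_distrib)
  moreover have "x \<bullet> (cproj I *v (C *v p)) = p \<bullet> (C *v p)"
    unfolding inner_matrix_vector[of x "cproj I"] dag_cproj p_def ..
  moreover have "p \<bullet> x = p \<bullet> p"
    using inner_matrix_vector[of p "cproj I" x]
    by (simp add: p_def matrix_vector_mul_assoc)
  then have "x \<bullet> (x - p) = (x - p) \<bullet> (x - p)"
    by (simp add: inner_diff_left inner_diff_right inner_commute[of x p])
  ultimately show ?thesis unfolding p_def by simp
qed

text \<open>\<open>I\<close> indexes rows of \<open>C\<close> that form a basis of the row space. A
  zero of the pivot form is supported on \<open>I\<close> and lies in the kernel of \<open>C\<close>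
  by \<open>psd_kernel\<close>, so it would be a dependence among these rows.\<close>

lemma exists_pivot:
  assumes "psd C"
  obtains I where "card I = rank C" "posdef (piv I C)"
proof -
  have C: "dag C = C" "\<And>x. 0 \<le> x \<bullet> (C *v x)" using assms by (auto simp: psd_iff)
  obtain B where B: "B \<subseteq> range (($) C)" "vec.independent B" "card B = rank C"
    using vec.basis_exists[of "range (($) C)"] by (metis rank_eq_dim_range)
  obtain I where I: "inj_on (($) C) I" "B = ($) C ` I"
    using B(1) unfolding subset_image_inj by auto
  have "posdef (piv I C)"
    unfolding posdef_def
  proof (intro allI impI)
    fix x :: "complex^'a" assume x: "x \<noteq> 0"
    have "x \<bullet> (piv I C *v x) \<noteq> 0"
    proof
      assume 0: "x \<bullet> (piv I C *v x) = 0"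
      then have "(cproj I *v x) \<bullet> (C *v (cproj I *v x)) = 0" "(x - cproj I *v x) \<bullet> (x - cproj I *v x) = 0"
        using C(2)[of "cproj I *v x"] inner_ge_zero[of "x - cproj I *v x"] unfolding inner_piv by linarith+
      then have Px: "cproj I *v x = x" and "C *v x = 0" using psd_kernel[OF assms, of x] by auto
      define c where "c v = cnj (x $ (inv_into I (($) C) v))" for v
      have "(\<Sum>v\<in>B. c v *s v) = (\<Sum>i\<in>I. cnj (x $ i) *s C $ i)"
        unfolding I(2) by (simp add: sum.reindex[OF I(1)] c_def I(1))
      also have "\<dots> = 0"
      proof -
        have "(\<Sum>i\<in>I. cnj (x $ i) * C $ i $ j) = cnj ((C *v x) $ j)" for j
        proof -
          have "x $ i = 0" if "i \<notin> I" for i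
            using arg_cong[OF Px, of "\<lambda>v. v $ i"] that by (simp add: cproj_vector)
          then have "(\<Sum>i\<in>I. cnj (x $ i) * C $ i $ j) = (\<Sum>i\<in>UNIV. cnj (x $ i) * C $ i $ j)"
            by (intro sum.mono_neutral_left) auto
          also have "\<dots> = (\<Sum>i\<in>UNIV. cnj (x $ i) * cnj (C $ j $ i))"
            using C(1) by (intro sum.cong) (auto simp: dag_def vec_eq_iff)
          finally show ?thesis by (simp add: matrix_vector_mult_def mult.commute)
        qed
        then show ?thesis by (simp add: vec_eq_iff \<open>C *v x = 0\<close>)
      qed
      finally have "\<forall>v\<in>B. c v = 0"
        using B(2) I(2) by (auto simp: vec.dependent_finite)
      then have "\<forall>i\<in>I. x $ i = 0" unfolding I(2) c_def by (simp add: I(1))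
      then have "x = 0" using Px by (auto simp: vec_eq_iff cproj_vector split: if_splits)
      with x show False by simp
    qed
    moreover have "0 \<le> x \<bullet> (piv I C *v x)"
      unfolding inner_piv using C(2)[of "cproj I *v x"] by simp
    ultimately show "0 < x \<bullet> (piv I C *v x)" by simp
  qed
  moreover have "card I = rank C" using B(3) I by (simp add: card_image)
  ultimately show ?thesis using that by blast
qed

subsection \<open>Dimensions of spaces of Hermitian matrices\<close>

text \<open>The map \<open>h\<close> identifies real matrices with Hermitian ones: the symmetric
  part gives the real parts and the antisymmetric part the imaginary parts. The support condition
  becomes the vanishing of coordinates.\<close>

lemma dim_hermitian_cproj:
  "dim {E :: complex^'n^'n. dag E = E \<and> cproj I ** E = 0} = (card (- I))\<^sup>2"
proof -
  define h :: "real^'n^'n \<Rightarrow> complex^'n^'n"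
    where "h Y = (\<chi> i j. Complex (Y $ i $ j + Y $ j $ i) (Y $ i $ j - Y $ j $ i))" for Y
  define d :: "(real^'n^'n) set" where "d = (\<lambda>(i, j). axis i (axis j 1)) ` ((- I) \<times> (- I))"
  define Z where "Z = {Y :: real^'n^'n. \<forall>i\<in>Basis. i \<notin> d \<longrightarrow> Y \<bullet> i = 0}"
  have Basis: "(Basis :: (real^'n^'n) set) = range (\<lambda>(i, j). axis i (axis j 1))"
    by (auto simp: Basis_vec_def image_iff)
  have inj: "inj (\<lambda>(i, j). axis i (axis j 1) :: real^'n^'n)"
    by (auto simp: inj_on_def axis_eq_axis)
  have mem_d: "axis i (axis j 1) \<in> d \<longleftrightarrow> i \<notin> I \<and> j \<notin> I" for i j
    unfolding d_def by (auto simp: image_iff axis_eq_axis)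
  have Z: "Z = {Y. \<forall>i j. i \<in> I \<or> j \<in> I \<longrightarrow> Y $ i $ j = 0}"
    unfolding Z_def Basis by (auto simp: mem_d inner_axis)
  have "dim Z = card d"
    unfolding Z_def by (rule dim_substandard) (auto simp: d_def Basis)
  also have "\<dots> = (card (- I))\<^sup>2"
    unfolding d_def by (subst card_image[OF inj_on_subset[OF inj]]) (auto simp: power2_eq_square)
  finally have dimZ: "dim Z = (card (- I))\<^sup>2" .
  have h: "linear h"
    by (simp add: linear_iff h_def vec_eq_iff complex_eq_iff algebra_simps)
  have "inj h"
  proof (rule injI)
    fix X Y assume "h X = h Y"
    then have "X $ i $ j + X $ j $ i = Y $ i $ j + Y $ j $ i \<and> X $ i $ j - X $ j $ i = Y $ i $ j - Y $ j $ i" for i j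
      by (simp add: h_def vec_eq_iff)
    then have "X $ i $ j = Y $ i $ j" for i j by (smt (verit))
    then show "X = Y" by (simp add: vec_eq_iff)
  qed
  then have "dim (h ` Z) = dim Z"
    by (intro dim_image_eq[OF h]) (auto intro: inj_on_subset)
  moreover have "h ` Z = {E. dag E = E \<and> cproj I ** E = 0}"
  proof (intro equalityI subsetI)
    fix E assume "E \<in> h ` Z"
    then show "E \<in> {E. dag E = E \<and> cproj I ** E = 0}"
      unfolding Z by (auto simp: h_def dag_def cproj_mult vec_eq_iff complex_eq_iff)
  next
    fix E assume "E \<in> {E. dag E = E \<and> cproj I ** E = 0}"
    then have E: "\<And>i j. cnj (E $ j $ i) = E $ i $ j" "\<And>i j. i \<in> I \<Longrightarrow> E $ i $ j = 0"
      by (auto simp: dag_def cproj_mult vec_eq_iff split: if_splits)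
    \<comment> \<open>Inverse of \<open>h\<close>: adding real and imaginary part of an entry leaves
      \<open>2 * Y $ i $ j\<close>.\<close>
    define Y :: "real^'n^'n" where "Y = (\<chi> i j. (Re (E $ i $ j) + Im (E $ i $ j)) / 2)"
    have E': "Re (E $ j $ i) = Re (E $ i $ j)" "Im (E $ j $ i) = - Im (E $ i $ j)" for i j
      using arg_cong[OF E(1)[of j i], of Re] arg_cong[OF E(1)[of j i], of Im] by auto
    have "Y \<in> Z" unfolding Z
    proof (safe; simp add: Y_def E(2))
      fix i j assume "j \<in> I"
      then show "Re (E $ i $ j) + Im (E $ i $ j) = 0"
        using E(2)[of j i] E'[of i j] by simp
    qed
    moreover have "h Y $ i $ j = E $ i $ j" for i j
      by (simp add: h_def Y_def complex_eq_iff E'[of i j] field_simps)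
    then have "h Y = E" by (simp add: vec_eq_iff)
    ultimately show "E \<in> h ` Z" by blast
  qed
  ultimately show ?thesis using dimZ by simp
qed

lemma dim_hermitian: "dim {E :: complex^'n^'n. dag E = E} = CARD('n)\<^sup>2"
proof -
  have "cproj {} = (0 :: complex^'n^'n)" by (simp add: cproj_def vec_eq_iff)
  then show ?thesis using dim_hermitian_cproj[where 'n = 'n, of "{}"] by simp
qed

text \<open>Multiplication by the imaginary unit exchanges Hermitian and skew-Hermitian
  matrices.\<close>

lemma dim_skew_hermitian: "dim {E :: complex^'n^'n. dag E = - E} = CARD('n)\<^sup>2"
proof -
  define h :: "complex^'n^'n \<Rightarrow> complex^'n^'n" where "h E = (\<chi> i j. \<i> * E $ i $ j)" for E
  have hh: "h (h E) = - E" for E by (simp add: h_def vec_eq_iff flip: mult.assoc)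
  have dh: "dag (h E) = - h (dag E)" for E by (simp add: h_def dag_def vec_eq_iff)
  have h: "linear h" by (simp add: linear_iff h_def vec_eq_iff algebra_simps)
  have "inj h" by (metis hh injI neg_equal_iff_equal)
  then have "dim (h ` {E. dag E = E}) = dim {E :: complex^'n^'n. dag E = E}"
    by (intro dim_image_eq[OF h]) (auto intro: inj_on_subset)
  moreover have "h ` {E. dag E = E} = {E. dag E = - E}"
  proof (intro equalityI subsetI)
    fix E :: "complex^'n^'n" assume "E \<in> {E. dag E = - E}"
    then have "dag (- h E) = - h E" "h (- h E) = E"
      using hh dh by (auto simp: dag_minus linear_neg[OF h])
    then show "E \<in> h ` {E. dag E = E}" by (metis (mono_tags) image_eqI mem_Collect_eq)
  qed (auto simp: dh)
  ultimately show ?thesis by (simp add: dim_hermitian)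
qed

subsection \<open>The fixed-rank stratum as a level set\<close>

definition herm_part :: "complex^'n^'n \<Rightarrow> complex^'n^'n" where
  "herm_part C = (1/2) *\<^sub>R (C + dag C)"

lemma linear_herm_part: "linear herm_part"
  by (simp add: linear_iff herm_part_def dag_add dag_scaleR algebra_simps)

lemma dag_herm_part [simp]: "dag (herm_part C) = herm_part C"
  by (simp add: herm_part_def dag_add dag_scaleR add.commute)

lemma herm_part_of_hermitian: "dag C = C \<Longrightarrow> herm_part C = C"
  by (simp add: herm_part_def flip: scaleR_2)

text \<open>Composing with \<open>herm_part\<close> makes the Schur complement Hermitian on all of the ambient space;
  the deviation from Hermiticity is a separate component of \<open>defining_map\<close> below.\<close>

definition pivotal :: "'n set \<Rightarrow> (complex^'n^'n) set" where
  "pivotal I = {C. posdef (piv I (herm_part C))}"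

lemma linear_matrix_mult_left: "linear (\<lambda>Y :: complex^'n^'n. X ** Y)"
  and linear_matrix_mult_right: "linear (\<lambda>Y :: complex^'n^'n. Y ** X)" for X :: "complex^'n^'n"
  using bilinear_matrix_mult[where 'n = 'n] by (auto simp: bilinear_def)

lemma kdiff_on_piv:
  assumes "open U"
  shows "kdiff_on k U (\<lambda>C. piv I (herm_part C))"
  unfolding piv_def
  by (rule kdiff_on_add[OF assms kdiff_on_linear[OF assms linear_matrix_mult_right
        kdiff_on_linear[OF assms linear_matrix_mult_left
          kdiff_on_linear[OF assms linear_herm_part kdiff_on_ident[OF assms]]]]
        kdiff_on_const[OF assms]])

lemma open_pivotal: "open (pivotal I)"
proof -
  have "continuous_on UNIV (\<lambda>C. piv I (herm_part C))"
    using kdiff_on_Suc_imp_continuous_on kdiff_on_piv[OF open_UNIV] by blast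
  from open_vimage[OF open_posdef this] show ?thesis
    by (simp add: pivotal_def vimage_def)
qed

lemma kdiff_on_matrix_inv_piv:
  fixes I :: "'n::finite set"
  shows "kdiff_on k (pivotal I) (\<lambda>C. matrix_inv (piv I (herm_part C)))"
proof -
  note U = open_pivotal[of I]
  let ?M = "\<lambda>C. piv I (herm_part C)"
  \<comment> \<open>The pivot acts as an operator on matrices by left multiplication; its inverse
    operator applied to \<open>mat 1\<close> is the matrix inverse.\<close>
  have "kdiff_on k (pivotal I) (\<lambda>C. matrix_inv (?M C) ** mat 1)"
  proof (rule kdiff_on_inverse_operator[OF U, where A = "\<lambda>C N. ?M C ** N"
        and B = "\<lambda>C N. matrix_inv (?M C) ** N"])
    show "kdiff_on k (pivotal I) (\<lambda>C. ?M C ** N)" for N :: "complex^'n^'n"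
      by (rule kdiff_on_linear[OF U linear_matrix_mult_right kdiff_on_piv[OF U]])
  qed (simp_all add: linear_matrix_mult_left matrix_mul_assoc posdef_matrix_inv pivotal_def)
  then show ?thesis by simp
qed

lemma kdiff_on_schur: "kdiff_on k (pivotal I) (\<lambda>C. schur I (herm_part C))"
proof -
  note U = open_pivotal[of I] and bil = kdiff_on_bilinear[OF open_pivotal bilinear_matrix_mult]
  have H: "kdiff_on k (pivotal I) herm_part"
    by (rule kdiff_on_linear[OF U linear_herm_part kdiff_on_ident[OF U]])
  have P: "kdiff_on k (pivotal I) (\<lambda>C. cproj I)" by (rule kdiff_on_const[OF U])
  show ?thesis
    unfolding schur_def
    by (rule kdiff_on_diff[OF U H bil[OF bil[OF bil[OF bil[OF H P] kdiff_on_matrix_inv_piv] P] H]])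
qed

lemma kdiff_on_Pair:
  assumes "open U" "kdiff_on k U f" "kdiff_on k U g"
  shows "kdiff_on k U (\<lambda>x. (f x, g x))"
proof -
  have "kdiff_on k U (\<lambda>x. (f x, 0) + (0, g x))"
    by (rule kdiff_on_add[OF assms(1) kdiff_on_linear[OF assms(1) _ assms(2), of "\<lambda>y. (y, 0)"]
          kdiff_on_linear[OF assms(1) _ assms(3), of "\<lambda>y. (0, y)"]])
       (simp_all add: linear_iff)
  then show ?thesis by simp
qed

section \<open>Partial trace and operators acting on system A alone\<close>

lemma linear_ptrace: "linear (ptrace_B :: ('s::finite, 't::finite) cmat \<Rightarrow> _)"
  by (simp add: linear_iff ptrace_B_def vec_eq_iff sum.distrib scaleR_sum_right)

lemma ptrace_dag: "ptrace_B (dag C) = dag (ptrace_B C)"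
  by (simp add: ptrace_B_def dag_def vec_eq_iff)

definition tensor_one :: "complex^'s^'s \<Rightarrow> ('s::finite, 't::finite) cmat" where
  "tensor_one y = (\<chi> i j. if snd i = snd j then y $ fst i $ fst j else 0)"

lemma tensor_one_mat_1: "tensor_one (mat 1) = mat 1"
  by (auto simp: tensor_one_def mat_def vec_eq_iff prod_eq_iff)

lemma linear_tensor_one: "linear tensor_one"
  by (simp add: linear_iff tensor_one_def vec_eq_iff)

lemma dag_tensor_one: "dag (tensor_one y) = tensor_one (dag y)"
  by (simp add: tensor_one_def dag_def vec_eq_iff)

lemma ptrace_tensor_one_mult: "ptrace_B (tensor_one y ** C) = y ** ptrace_B C"
proof -
  have "(tensor_one y ** C) $ (a, b) $ j = (\<Sum>a'\<in>UNIV. y $ a $ a' * C $ (a', b) $ j)" for a b j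
  proof -
    have "(tensor_one y ** C) $ (a, b) $ j
        = (\<Sum>(a', b')\<in>UNIV \<times> UNIV. (if b = b' then y $ a $ a' else 0) * C $ (a', b') $ j)"
      by (simp add: tensor_one_def matrix_matrix_mult_def case_prod_unfold cong: if_cong)
    also have "\<dots> = (\<Sum>a'\<in>UNIV. \<Sum>b'\<in>UNIV. (if b = b' then y $ a $ a' * C $ (a', b') $ j else 0))"
      by (subst sum.cartesian_product[symmetric]) (intro sum.cong, auto)
    finally show ?thesis by simp
  qed
  then have "ptrace_B (tensor_one y ** C) $ a $ c = (\<Sum>b\<in>UNIV. \<Sum>a'\<in>UNIV. y $ a $ a' * C $ (a', b) $ (c, b))" for a c
    by (simp add: ptrace_B_def)
  also have "(\<Sum>b\<in>UNIV. \<Sum>a'\<in>UNIV. y $ a $ a' * C $ (a', b) $ (c, b)) = (y ** ptrace_B C) $ a $ c" for a c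
    by (subst sum.swap) (simp add: ptrace_B_def matrix_matrix_mult_def sum_distrib_left)
  finally show ?thesis by (simp add: vec_eq_iff)
qed

lemma ptrace_mult_tensor_one:
  "ptrace_B (C ** tensor_one y) = ptrace_B C ** y"
proof -
  have "ptrace_B (dag (C ** tensor_one y)) = dag y ** ptrace_B (dag C)"
    by (simp add: dag_mult dag_tensor_one ptrace_tensor_one_mult)
  then have "dag (dag (ptrace_B (C ** tensor_one y))) = dag (dag y ** dag (ptrace_B C))"
    by (simp add: ptrace_dag)
  then show ?thesis by (simp add: dag_mult)
qed

lemma choi_iff:
  "C \<in> (choi :: ('s::finite, 't::finite) cmat set) \<longleftrightarrow>
    psd C \<and> ptrace_B C = (1 / real CARD('s)) *\<^sub>R mat 1"
  by (simp add: choi_def)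

lemma choi_rankD:
  assumes "C \<in> choi_rank r"
  shows "psd C" "dag C = C" "rank C = r" "C \<in> choi"
  using assms by (auto simp: choi_rank_def choi_iff psd_iff)

definition defining_map :: "('s \<times> 't) set \<Rightarrow> ('s::finite, 't::finite) cmat \<Rightarrow>
    ('s, 't) cmat \<times> ('s, 't) cmat \<times> (complex^'s^'s)" where
  "defining_map I C = (C - dag C, schur I (herm_part C),
     ptrace_B (herm_part C) - (1 / real CARD('s)) *\<^sub>R mat 1)"

text \<open>The components of \<open>defining_map\<close> are redundant as functions into the full
  product; this is the subspace where their values lie and onto which the derivative is
  surjective.\<close>

definition defining_target :: "('s \<times> 't) set \<Rightarrow>
    (('s::finite, 't::finite) cmat \<times> ('s, 't) cmat \<times> (complex^'s^'s)) set" where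
  "defining_target I = {K. dag K = - K} \<times> {E. dag E = E \<and> cproj I ** E = 0} \<times> {Z. dag Z = Z}"

lemma kdiff_on_defining_map: "kdiff_on k (pivotal I) (defining_map I)"
proof -
  note U = open_pivotal[of I]
  have id: "kdiff_on k (pivotal I) (\<lambda>C. C)" by (rule kdiff_on_ident[OF U])
  have "kdiff_on k (pivotal I) (\<lambda>C. (C - dag C, schur I (herm_part C),
     ptrace_B (herm_part C) - (1 / real CARD('a)) *\<^sub>R mat 1))"
    by (rule kdiff_on_Pair[OF U kdiff_on_diff[OF U id kdiff_on_linear[OF U linear_dag id]]
          kdiff_on_Pair[OF U kdiff_on_schur kdiff_on_diff[OF U kdiff_on_linear[OF U linear_ptrace
                kdiff_on_linear[OF U linear_herm_part id]] kdiff_on_const[OF U]]]])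
  then show ?thesis by (simp add: defining_map_def[abs_def])
qed

lemma defining_map_in_target:
  fixes I :: "('s::finite \<times> 't::finite) set"
  shows "defining_map I ` pivotal I \<subseteq> defining_target I"
proof (rule image_subsetI)
  fix C :: "('s, 't) cmat" assume "C \<in> pivotal I"
  then have C: "posdef (piv I (herm_part C))" by (simp add: pivotal_def)
  show "defining_map I C \<in> defining_target I"
    by (simp add: defining_map_def defining_target_def dag_diff dag_schur[OF C] cproj_schur[OF C]
        ptrace_dag[symmetric] dag_scaleR)
qed

lemma subspace_defining_target:
  "subspace (defining_target I :: (('s::finite, 't::finite) cmat \<times> ('s, 't) cmat \<times> (complex^'s^'s)) set)"
  unfolding defining_target_def
  by (intro subspace_Times) (auto simp: subspace_def dag_add dag_scaleR matrix_algebra matrix_scalar_ac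
      scalar_matrix_assoc[symmetric])

lemma dim_defining_target:
  "dim (defining_target I :: (('s::finite, 't::finite) cmat \<times> ('s, 't) cmat \<times> (complex^'s^'s)) set)
    = (CARD('s) * CARD('t))\<^sup>2 + (card (- I))\<^sup>2 + CARD('s)\<^sup>2"
proof -
  have s: "subspace {K :: ('s, 't) cmat. dag K = - K}"
    "subspace {E :: ('s, 't) cmat. dag E = E \<and> cproj I ** E = 0}"
    "subspace {Z :: complex^'s^'s. dag Z = Z}"
    by (auto simp: subspace_def dag_add dag_scaleR matrix_algebra matrix_scalar_ac
        scalar_matrix_assoc[symmetric])
  show ?thesis
    unfolding defining_target_def
    by (simp add: dim_Times subspace_Times s dim_hermitian dim_hermitian_cproj dim_skew_hermitian)
qed

lemma defining_map_eq_0_iff: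
  assumes "C \<in> pivotal I"
  shows "defining_map I C = 0 \<longleftrightarrow> C \<in> choi_rank (card I)"
proof (cases "dag C = C")
  case True
  have "posdef (piv I C)"
    using assms herm_part_of_hermitian[OF True] by (simp add: pivotal_def)
  from rank_psd_iff_schur[OF this True] show ?thesis
    using herm_part_of_hermitian[OF True] True
    by (auto simp: defining_map_def choi_rank_def choi_iff zero_prod_def)
next
  case False
  then show ?thesis
    by (auto simp: defining_map_def zero_prod_def dest: choi_rankD)
qed

lemma exists_pivotal:
  assumes "C \<in> choi_rank r"
  obtains I where "card I = r" "C \<in> pivotal I" "posdef (piv I C)" "schur I C = 0"
proof -
  note C = choi_rankD[OF assms]
  obtain I where I: "card I = rank C" "posdef (piv I C)" using exists_pivot[OF C(1)] by metis
  then show ?thesis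
    using that C rank_eq_card_iff[OF I(2)] herm_part_of_hermitian[OF C(2)] by (simp add: pivotal_def)
qed

lemma pivotal_hermitian: "dag C = C \<Longrightarrow> C \<in> pivotal I \<longleftrightarrow> posdef (piv I C)"
  by (simp add: pivotal_def herm_part_of_hermitian)

text \<open>The pivot of \<open>C\<close> is the product of the padded \<open>I\<close>-blocks of
  \<open>L\<close> and \<open>R\<close>, so that of \<open>L\<close> is invertible, and its inverse
  \<open>N\<close> gives \<open>C = (L ** N) ** cproj I ** C\<close>.\<close>

lemma schur_eq_0_of_factor:
  assumes "posdef (piv I C)" "C = L ** cproj I ** R"
  shows "schur I C = 0"
proof -
  let ?P = "cproj I"
  let ?A = "?P ** L ** ?P + (mat 1 - ?P)"
  have "piv I C = ?A ** (?P ** R ** ?P + (mat 1 - ?P))"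
    by (simp add: piv_def assms(2) matrix_algebra)
  then have "?A ** ((?P ** R ** ?P + (mat 1 - ?P)) ** matrix_inv (piv I C)) = mat 1"
    using posdef_matrix_inv(1)[OF assms(1)] by (simp add: matrix_mul_assoc)
  then obtain N where "N ** ?A = mat 1" using matrix_left_right_inverse by blast
  then have "N ** (?A ** ?P) = ?P" by (simp add: matrix_mul_assoc)
  then have N: "N ** ?P ** L ** ?P = ?P" by (simp add: matrix_algebra)
  have "L ** (N ** ?P ** L ** ?P) ** R = C" unfolding N assms(2) by (simp add: matrix_mul_assoc)
  then have "C = (L ** N) ** ?P ** C" by (simp add: assms(2) matrix_mul_assoc)
  then show ?thesis unfolding schur_eq_0_iff[OF assms(1)] by blast
qed

text \<open>For a target \<open>w = (K, E, Z)\<close> an explicit curve through \<open>p\<close> is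
  built on which \<open>defining_map I\<close> equals \<open>t *\<^sub>R w\<close> up to a term of
  order \<open>t\<^sup>2\<close>; its velocity \<open>v\<close> then satisfies
  \<open>D v = w\<close>.\<close>

lemma defining_map_submersion:
  fixes p :: "('s::finite, 't::finite) cmat"
  assumes p: "p \<in> choi_rank (card I)" and pI: "p \<in> pivotal I"
    and D: "(defining_map I has_derivative D) (at p)"
  shows "defining_target I \<subseteq> range D"
proof
  fix w :: "('s, 't) cmat \<times> ('s, 't) cmat \<times> (complex^'s^'s)"
  assume "w \<in> defining_target I"
  then obtain K E Z where w: "w = (K, E, Z)" and K: "dag K = - K" and E: "dag E = E" "cproj I ** E = 0"
    and Z: "dag Z = Z" by (auto simp: defining_target_def)
  define c where "c = 1 / real CARD('s)"
  have c: "c > 0" by (simp add: c_def)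
  note C = choi_rankD[OF p]
  have pp: "posdef (piv I p)" using pI pivotal_hermitian[OF C(2)] by simp
  have tr: "ptrace_B p = c *\<^sub>R mat 1" using C(4) by (simp add: choi_iff c_def)
  \<comment> \<open>The summand \<open>E\<close> already changes the partial trace by
    \<open>ptrace_B E\<close>, and the congruence adds \<open>2 * c\<close> times \<open>y\<close>
    to first order, so this \<open>y\<close> makes the total \<open>Z\<close>.\<close>
  define y where "y = (1 / (2 * c)) *\<^sub>R (Z - ptrace_B E)"
  have y: "dag y = y" by (simp add: y_def dag_scaleR dag_diff Z ptrace_dag[symmetric] E)
  define Y :: "('s, 't) cmat" where "Y = tensor_one y"
  have Y: "dag Y = Y" by (simp add: Y_def dag_tensor_one y)
  define C' where "C' t = (mat 1 + t *\<^sub>R Y) ** p ** (mat 1 + t *\<^sub>R Y)" for t :: real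
  define v where "v = (1/2) *\<^sub>R K + E + Y ** p + p ** Y"
  \<comment> \<open>The quadratic term completes the first-order motion to an exact congruence. Half
    of \<open>K\<close> in \<open>v\<close> suffices because subtracting the adjoint doubles
    it.\<close>
  define \<gamma> where "\<gamma> t = p + t *\<^sub>R v + t\<^sup>2 *\<^sub>R (Y ** p ** Y)" for t
  have C'_eq: "C' t = p + t *\<^sub>R (Y ** p + p ** Y) + t\<^sup>2 *\<^sub>R (Y ** p ** Y)" for t
    by (simp add: C'_def matrix_algebra matrix_scalar_ac scalar_matrix_assoc[symmetric]
        scaleR_add_right power2_eq_square)
  have \<gamma>_eq: "\<gamma> t = C' t + t *\<^sub>R E + (t/2) *\<^sub>R K" for t
    by (simp add: \<gamma>_def v_def C'_eq algebra_simps)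
  have dC': "dag (C' t) = C' t" for t
    by (simp add: C'_def dag_mult dag_add dag_scaleR Y C(2) matrix_mul_assoc)
  have dag\<gamma>: "dag (\<gamma> t) = C' t + t *\<^sub>R E - (t/2) *\<^sub>R K" for t
    by (simp add: \<gamma>_eq dag_add dag_scaleR dC' E K)
  have herm: "herm_part (\<gamma> t) = C' t + t *\<^sub>R E" for t
  proof -
    have "\<gamma> t + dag (\<gamma> t) = 2 *\<^sub>R (C' t + t *\<^sub>R E)"
      unfolding dag\<gamma> unfolding \<gamma>_eq scaleR_2 by simp
    then show ?thesis by (simp add: herm_part_def)
  qed
  have EP: "E ** cproj I = 0"
    using arg_cong[OF E(2), of dag] by (simp add: dag_mult E(1))
  \<comment> \<open>As \<open>E\<close> lives off \<open>I\<close>, adding it leaves the pivot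
    unchanged and shifts the Schur complement by exactly \<open>t *\<^sub>R E\<close>.\<close>
  have piv: "piv I (C' t + t *\<^sub>R E) = piv I (C' t)" for t
    by (simp add: piv_def matrix_algebra matrix_scalar_ac scalar_matrix_assoc[symmetric] E)
  have F: "defining_map I (\<gamma> t) = t *\<^sub>R w + t\<^sup>2 *\<^sub>R (0, 0, c *\<^sub>R (y ** y))"
    if "\<gamma> t \<in> pivotal I" for t
  proof -
    have pos: "posdef (piv I (C' t))" using that by (simp add: pivotal_def herm piv)
    have 0: "schur I (C' t) = 0"
    proof -
      have "schur I p = 0" using rank_eq_card_iff[OF pp] C(3) by simp
      then obtain X where X: "p = X ** cproj I ** p" using schur_eq_0_iff[OF pp] by blast
      have "C' t = ((mat 1 + t *\<^sub>R Y) ** X) ** cproj I ** (p ** (mat 1 + t *\<^sub>R Y))"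
        unfolding C'_def
        using arg_cong[OF X, of "\<lambda>A. (mat 1 + t *\<^sub>R Y) ** A ** (mat 1 + t *\<^sub>R Y)"]
        by (simp only: matrix_mul_assoc)
      then show ?thesis by (rule schur_eq_0_of_factor[OF pos])
    qed
    have "schur I (C' t + t *\<^sub>R E) = schur I (C' t) + t *\<^sub>R E"
    proof -
      have "(C' t + t *\<^sub>R E) ** cproj I = C' t ** cproj I"
        by (simp add: matrix_algebra scalar_matrix_assoc[symmetric] EP)
      moreover have "A ** cproj I ** (C' t + t *\<^sub>R E) = A ** cproj I ** C' t" for A :: "('s, 't) cmat"
        by (simp add: matrix_add_ldistrib matrix_scalar_ac scalar_matrix_assoc[symmetric]
            matrix_mul_assoc[symmetric] E(2))
      ultimately show ?thesis unfolding schur_def piv by simp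
    qed
    then have 2: "schur I (herm_part (\<gamma> t)) = t *\<^sub>R E" by (simp add: herm 0)
    have 1: "\<gamma> t - dag (\<gamma> t) = t *\<^sub>R K"
    proof -
      have "\<gamma> t - dag (\<gamma> t) = (t/2) *\<^sub>R K + (t/2) *\<^sub>R K"
        unfolding dag\<gamma> unfolding \<gamma>_eq by simp
      then show ?thesis by (metis field_sum_of_halves scaleR_left_distrib)
    qed
    have one: "mat 1 + t *\<^sub>R Y = tensor_one (mat 1 + t *\<^sub>R y)"
      by (simp add: Y_def linear_add[OF linear_tensor_one] linear_scale[OF linear_tensor_one]
          tensor_one_mat_1)
    have "ptrace_B (C' t) = c *\<^sub>R ((mat 1 + t *\<^sub>R y) ** (mat 1 + t *\<^sub>R y))"
      unfolding C'_def one ptrace_mult_tensor_one ptrace_tensor_one_mult tr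
      by (simp add: matrix_scalar_ac scalar_matrix_assoc[symmetric])
    also have "\<dots> = c *\<^sub>R mat 1 + t *\<^sub>R ((2 * c) *\<^sub>R y) + t\<^sup>2 *\<^sub>R (c *\<^sub>R (y ** y))"
    proof -
      have "(mat 1 + u) ** (mat 1 + u) = mat 1 + 2 *\<^sub>R u + u ** u" for u :: "complex^'s^'s"
        by (simp only: matrix_algebra matrix_mul_lid matrix_mul_rid scaleR_2 add_ac)
      from this[of "t *\<^sub>R y"] show ?thesis
        by (simp add: matrix_scalar_ac scalar_matrix_assoc[symmetric] scaleR_add_right
            power2_eq_square mult_ac)
    qed
    also have "(2 * c) *\<^sub>R y = Z - ptrace_B E" using c by (simp add: y_def)
    finally have 3: "ptrace_B (herm_part (\<gamma> t)) - c *\<^sub>R mat 1 = t *\<^sub>R Z + t\<^sup>2 *\<^sub>R (c *\<^sub>R (y ** y))"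
      by (simp add: herm linear_add[OF linear_ptrace] linear_scale[OF linear_ptrace] algebra_simps)
    show ?thesis
      unfolding defining_map_def 1 2 3[unfolded c_def] w by (simp add: c_def)
  qed
  have d\<gamma>: "(\<gamma> has_derivative (\<lambda>t. t *\<^sub>R v)) (at 0)"
    unfolding \<gamma>_def by (auto intro!: derivative_eq_intros)
  have \<gamma>0: "\<gamma> 0 = p" by (simp add: \<gamma>_def)
  have "((\<lambda>t. defining_map I (\<gamma> t)) has_derivative (\<lambda>t. D (t *\<^sub>R v))) (at 0)"
    by (rule has_derivative_compose[OF d\<gamma>]) (simp add: D \<gamma>0)
  moreover have "((\<lambda>t. defining_map I (\<gamma> t)) has_derivative (\<lambda>t. t *\<^sub>R w)) (at 0)"
  proof -
    \<comment> \<open>The formula \<open>F\<close> holds only while the curve stays in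
      \<open>pivotal I\<close>, which is true in a neighbourhood of 0.\<close>
    have "continuous_on UNIV \<gamma>" unfolding \<gamma>_def by (intro continuous_intros)
    then have op: "open (\<gamma> -` pivotal I)" by (intro open_vimage open_pivotal)
    have "((\<lambda>t. t *\<^sub>R w + t\<^sup>2 *\<^sub>R q) has_derivative (\<lambda>t. t *\<^sub>R w)) (at 0)" for q
      by (auto intro!: derivative_eq_intros)
    from has_derivative_transform_within_open[OF this op, of "(0, 0, c *\<^sub>R (y ** y))"] show ?thesis
      using pI \<gamma>0 F by simp
  qed
  ultimately have "(\<lambda>t. D (t *\<^sub>R v)) = (\<lambda>t. t *\<^sub>R w)" by (rule has_derivative_unique)
  from fun_cong[OF this, of 1] show "w \<in> range D" by auto
qed

subsection \<open>Extreme points\<close>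

text \<open>The difference of the endpoints of a segment through \<open>C\<close> vanishes on the
  kernel of \<open>C\<close>, because there both nonnegative forms are zero. Since
  \<open>C ** (mat 1 - G) = 0\<close>, this gives \<open>H = H ** G\<close>; norm 1 prepares a
  compactness argument.\<close>

lemma not_extreme_imp_perturbation:
  fixes C :: "('s::finite, 't::finite) cmat"
  assumes C: "C \<in> choi" "\<not> C extreme_point_of choi" and pos: "posdef (piv I C)" and 0: "schur I C = 0"
  obtains H where "norm H = 1" "dag H = H" "ptrace_B H = 0"
    "H = H ** (matrix_inv (piv I C) ** cproj I ** C)"
proof -
  define G where "G = matrix_inv (piv I C) ** cproj I ** C"
  have dC: "dag C = C" using C(1) by (simp add: choi_iff psd_iff)
  obtain a b where ab: "a \<in> choi" "b \<in> choi" "C \<in> open_segment a b"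
    using C by (auto simp: extreme_point_of_def)
  then obtain u where u: "a \<noteq> b" "0 < u" "u < 1" "C = (1 - u) *\<^sub>R a + u *\<^sub>R b"
    by (auto simp: in_segment)
  have psd: "psd a" "psd b" using ab by (auto simp: choi_iff)
  define H where "H = a - b"
  have ker: "H *v x = 0" if "C *v x = 0" for x
  proof -
    have "(1 - u) * (x \<bullet> (a *v x)) + u * (x \<bullet> (b *v x)) = x \<bullet> (C *v x)"
      by (simp add: u(4) matrix_vector_mult_add_rdistrib scaleR_matrix_vector inner_right_distrib)
    then have "(1 - u) * (x \<bullet> (a *v x)) + u * (x \<bullet> (b *v x)) = 0" using that by simp
    moreover have "0 \<le> x \<bullet> (a *v x)" "0 \<le> x \<bullet> (b *v x)" using psd by (auto simp: psd_iff)
    ultimately have "x \<bullet> (a *v x) = 0" "x \<bullet> (b *v x) = 0"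
      using u(2,3) by (auto simp: add_nonneg_eq_0_iff)
    then have "a *v x = 0" "b *v x = 0"
      using psd_kernel[OF psd(1)] psd_kernel[OF psd(2)] by blast+
    then show ?thesis
      by (simp add: H_def matrix_vector_mult_diff_rdistrib)
  qed
  have HG: "H = H ** G"
  proof -
    have "H *v ((mat 1 - G) *v x) = 0" for x
      using schur_eq_0_factor(2)[OF pos dC 0]
      by (intro ker) (simp add: matrix_vector_mul_assoc matrix_diff_ldistrib G_def)
    then have "H ** (mat 1 - G) = 0"
      by (simp add: matrix_eq matrix_vector_mul_assoc)
    then show ?thesis by (simp add: matrix_diff_ldistrib)
  qed
  have "H \<noteq> 0" using u(1) by (simp add: H_def)
  define H' where "H' = (1 / norm H) *\<^sub>R H"
  show ?thesis
  proof (rule that[of H'])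
    show "norm H' = 1" using \<open>H \<noteq> 0\<close> by (simp add: H'_def)
    show "dag H' = H'" using psd by (simp add: H'_def dag_scaleR H_def dag_diff psd_iff)
    show "ptrace_B H' = 0"
      using ab by (simp add: H'_def H_def choi_iff linear_scale[OF linear_ptrace] linear_diff[OF linear_ptrace])
    show "H' = H' ** (matrix_inv (piv I C) ** cproj I ** C)"
      using HG by (simp add: H'_def G_def scalar_matrix_assoc[symmetric])
  qed
qed

text \<open>Taking adjoints gives \<open>dag G ** H ** G = H\<close>, so adding a multiple of
  \<open>H\<close> to \<open>C\<close> amounts to adding it to the positive definite pivot. Openness
  of \<open>posdef\<close> permits small multiples of both signs, and \<open>C\<close> is a
  midpoint.\<close>

lemma perturbation_imp_not_extreme:
  fixes C :: "('s::finite, 't::finite) cmat"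
  assumes C: "C \<in> choi" and pos: "posdef (piv I C)" and 0: "schur I C = 0"
    and H: "H \<noteq> 0" "dag H = H" "ptrace_B H = 0" "H = H ** (matrix_inv (piv I C) ** cproj I ** C)"
  shows "\<not> C extreme_point_of choi"
proof -
  define G where "G = matrix_inv (piv I C) ** cproj I ** C"
  have dC: "dag C = C" using C by (simp add: choi_iff psd_iff)
  have HG: "H ** G = H" using H(4) by (simp add: G_def)
  have "dag G ** H = H"
    using arg_cong[OF HG, of dag] by (simp add: dag_mult H(2))
  then have HGG: "dag G ** H ** G = H" by (simp add: HG)
  have CG: "C = dag G ** piv I C ** G"
    using schur_eq_0_factor(1)[OF pos dC 0] by (simp add: G_def)
  obtain e where e: "e > 0" "ball (piv I C) e \<subseteq> {N. posdef N}"
    using open_posdef pos by (metis mem_Collect_eq openE)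
  define d where "d = e / (2 * norm H)"
  have d: "d > 0" using e H(1) by (simp add: d_def)
  have mem: "C + t *\<^sub>R H \<in> choi" if "\<bar>t\<bar> = d" for t
  proof -
    have "piv I C + t *\<^sub>R H \<in> ball (piv I C) e"
      using that e H(1) by (simp add: dist_norm d_def)
    then have pos': "posdef (piv I C + t *\<^sub>R H)" using e by auto
    have eq: "C + t *\<^sub>R H = dag G ** (piv I C + t *\<^sub>R H) ** G"
      using CG HGG by (simp add: matrix_algebra matrix_scalar_ac scalar_matrix_assoc[symmetric])
    have "0 \<le> x \<bullet> ((C + t *\<^sub>R H) *v x)" for x
    proof -
      have "(C + t *\<^sub>R H) *v x = dag G *v ((piv I C + t *\<^sub>R H) *v (G *v x))"
        unfolding eq by (simp only: matrix_vector_mul_assoc matrix_mul_assoc)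
      then have "x \<bullet> ((C + t *\<^sub>R H) *v x) = (G *v x) \<bullet> ((piv I C + t *\<^sub>R H) *v (G *v x))"
        using inner_matrix_vector[of x "dag G"] by simp
      also have "\<dots> \<ge> 0"
        using pos' by (cases "G *v x = 0") (auto simp: posdef_def less_imp_le)
      finally show ?thesis .
    qed
    then show ?thesis
      using C H by (simp add: choi_iff psd_iff dag_add dag_scaleR linear_add[OF linear_ptrace]
          linear_scale[OF linear_ptrace])
  qed
  have "C + d *\<^sub>R H \<in> choi" "C + (-d) *\<^sub>R H \<in> choi" by (rule mem, use d in simp)+
  moreover have "C \<in> open_segment (C + d *\<^sub>R H) (C + (-d) *\<^sub>R H)"
  proof -
    have "d *\<^sub>R H \<noteq> 0" using d H(1) by simp
    then have "C + d *\<^sub>R H \<noteq> C + (-d) *\<^sub>R H"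
      by (metis add_left_cancel d less_irrefl neg_equal_0_iff_equal scaleR_cancel_right equal_neg_zero H(1))
    moreover have "C = (1 - 1/2) *\<^sub>R (C + d *\<^sub>R H) + (1/2) *\<^sub>R (C + (-d) *\<^sub>R H)"
      by (simp add: algebra_simps flip: scaleR_left_distrib)
    ultimately show ?thesis unfolding in_segment by (intro conjI exI[of _ "1/2"]) auto
  qed
  ultimately show ?thesis by (auto simp: extreme_point_of_def)
qed

lemma openin_choi_ext:
  "openin (top_of_set (choi_rank r :: ('s::finite, 't::finite) cmat set)) (choi_ext r)"
  unfolding openin_euclidean_subtopology_iff
proof (intro conjI ballI)
  show "choi_ext r \<subseteq> (choi_rank r :: ('s, 't) cmat set)" by (auto simp: choi_ext_def)
next
  fix p :: "('s, 't) cmat" assume p: "p \<in> choi_ext r"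
  then have pr: "p \<in> choi_rank r" and ext: "p extreme_point_of choi" by (auto simp: choi_ext_def)
  obtain I where I: "card I = r" "p \<in> pivotal I" "posdef (piv I p)" "schur I p = 0"
    using exists_pivotal[OF pr] by metis
  define G where "G C = matrix_inv (piv I (herm_part C)) ** cproj I ** C" for C
  show "\<exists>e>0. \<forall>C\<in>choi_rank r. dist C p < e \<longrightarrow> C \<in> choi_ext r"
  proof (rule ccontr)
    assume neg: "\<not> ?thesis"
    obtain e where e: "e > 0" "ball p e \<subseteq> pivotal I" using open_pivotal I(2) openE by metis
    \<comment> \<open>Every chosen \<open>C\<close> lies within \<open>e\<close> of
      \<open>p\<close>, so the index set \<open>I\<close> found at \<open>p\<close> serves the whole
      sequence.\<close>
    have "\<exists>C H. C \<in> choi_rank r \<and> dist C p < e / real (Suc k) \<and> C \<in> pivotal I \<and>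
        norm H = 1 \<and> dag H = H \<and> ptrace_B H = 0 \<and> H = H ** G C" for k
    proof -
      have "e / real (Suc k) > 0" using e(1) by simp
      then obtain C where C: "C \<in> choi_rank r" "dist C p < e / real (Suc k)" "C \<notin> choi_ext r"
        using neg by blast
      have "e / real (Suc k) \<le> e" using e(1) by (simp add: divide_le_eq)
      then have mem: "C \<in> pivotal I" using C(2) e(2) by (auto simp: dist_commute)
      note c = choi_rankD[OF C(1)]
      have pos: "posdef (piv I C)" using mem pivotal_hermitian[OF c(2)] by simp
      have "schur I C = 0" using rank_eq_card_iff[OF pos] c(3) I(1) by simp
      moreover have "\<not> C extreme_point_of choi" using C by (auto simp: choi_ext_def)
      ultimately show ?thesis
        using not_extreme_imp_perturbation[OF c(4) _ pos] C mem herm_part_of_hermitian[OF c(2)]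
        unfolding G_def by metis
    qed
    then obtain C H where CH: "\<And>k :: nat. C k \<in> choi_rank r" "\<And>k. dist (C k) p < e / real (Suc k)"
      "\<And>k. C k \<in> pivotal I" "\<And>k. norm (H k) = 1" "\<And>k. dag (H k) = H k"
      "\<And>k. ptrace_B (H k) = 0" "\<And>k. H k = H k ** G (C k)"
      by metis
    have limC: "C \<longlonglongrightarrow> p"
    proof (rule metric_LIMSEQ_I)
      have "(\<lambda>k. e / real (Suc k)) \<longlonglongrightarrow> 0"
        using LIMSEQ_inverse_real_of_nat[THEN tendsto_mult_left, of e] by (simp add: divide_inverse)
      fix d :: real assume "d > 0"
      with \<open>(\<lambda>k. e / real (Suc k)) \<longlonglongrightarrow> 0\<close> obtain N where "\<forall>n\<ge>N. \<bar>e / real (Suc n)\<bar> < d"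
        by (metis LIMSEQ_D diff_zero real_norm_def)
      then show "\<exists>N. \<forall>n\<ge>N. dist (C n) p < d"
        using CH(2) by (metis abs_less_iff less_trans)
    qed
    have "\<forall>k. H k \<in> sphere 0 1" using CH(4) by simp
    then obtain h s where h: "h \<in> sphere 0 1" "strict_mono (s :: nat \<Rightarrow> nat)" "(H \<circ> s) \<longlonglongrightarrow> h"
      using compact_sphere[of "0 :: ('s, 't) cmat" 1] unfolding compact_def by metis
    have limCs: "(\<lambda>k. C (s k)) \<longlonglongrightarrow> p"
      using LIMSEQ_subseq_LIMSEQ[OF limC h(2)] by (simp add: o_def)
    have limH: "(\<lambda>k. H (s k)) \<longlonglongrightarrow> h" using h(3) by (simp add: o_def)
    note bb = bilinear_matrix_mult[unfolded bilinear_conv_bounded_bilinear]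
    have cont: "continuous_on (pivotal I) G"
    proof -
      have "continuous_on (pivotal I) (\<lambda>C. matrix_inv (piv I (herm_part C)))"
        by (rule kdiff_on_Suc_imp_continuous_on[of 0]) (rule kdiff_on_matrix_inv_piv)
      from bounded_bilinear.continuous_on[OF bb bounded_bilinear.continuous_on[OF bb this continuous_on_const]
          continuous_on_id]
      show ?thesis by (simp add: G_def[abs_def])
    qed
    have limG: "(\<lambda>k. G (C (s k))) \<longlonglongrightarrow> G p"
      using continuous_on_tendsto_compose[OF cont limCs I(2)] CH(3) by simp
    have "(\<lambda>k. H (s k) ** G (C (s k))) \<longlonglongrightarrow> h ** G p"
      by (rule bounded_bilinear.tendsto[OF bb limH limG])
    then have "(\<lambda>k. H (s k)) \<longlonglongrightarrow> h ** G p" by (simp flip: CH(7))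
    then have hG: "h = h ** G p" using limH LIMSEQ_unique by blast
    have "(\<lambda>k. dag (H (s k))) \<longlonglongrightarrow> dag h"
      by (rule bounded_linear.tendsto[OF linear_dag[unfolded linear_conv_bounded_linear] limH])
    then have dh: "dag h = h" unfolding CH(5) using limH LIMSEQ_unique by blast
    have "(\<lambda>k. ptrace_B (H (s k))) \<longlonglongrightarrow> ptrace_B h"
      by (rule bounded_linear.tendsto[OF linear_ptrace[unfolded linear_conv_bounded_linear] limH])
    then have ph: "ptrace_B h = 0" unfolding CH(6) using LIMSEQ_unique tendsto_const by blast
    have "h \<noteq> 0" using h(1) by auto
    note c = choi_rankD[OF pr]
    have "\<not> p extreme_point_of choi"
      by (rule perturbation_imp_not_extreme[OF c(4) I(3,4) \<open>h \<noteq> 0\<close> dh ph])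
         (use hG herm_part_of_hermitian[OF c(2)] in \<open>simp add: G_def\<close>)
    with ext show False by simp
  qed
qed

section \<open>Charts for the extreme points, and an extreme point of rank \<open>s\<close>\<close>

text \<open>By openness the charts of the stratum, restricted to \<open>Op\<close>, are charts of
  the extreme points. With \<open>n = s * t\<close> the dimension is \<open>2 * n\<^sup>2\<close>
  minus \<open>n\<^sup>2 + (n - r)\<^sup>2 + s\<^sup>2\<close>.\<close>

lemma submanifold_dim_choi_ext:
  assumes r: "r \<le> CARD('s) * CARD('t)"
  shows "submanifold_dim (choi_ext r :: ('s::finite, 't::finite) cmat set)
    (2 * CARD('s) * r * CARD('t) - r ^ 2 - CARD('s) ^ 2)" (is "submanifold_dim ?M ?d")
proof -
  define n where "n = CARD('s) * CARD('t)"
  have DIM: "DIM(('s, 't) cmat) = 2 * n\<^sup>2" by (simp add: n_def power2_eq_square)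
  \<comment> \<open>\<open>submanifold_dim\<close> demands a subspace of the stated dimension even
    for an empty set.\<close>
  have d_le: "?d \<le> 2 * n\<^sup>2"
  proof -
    have "?d \<le> 2 * CARD('s) * r * CARD('t)" by simp
    also have "\<dots> = 2 * n * r" by (simp add: n_def)
    also have "\<dots> \<le> 2 * n * n" using r by (simp add: n_def)
    finally show ?thesis by (simp add: power2_eq_square)
  qed
  have "\<exists>L :: ('s, 't) cmat set. subspace L \<and> dim L = ?d"
    using choose_subspace_of_subspace[of ?d "UNIV :: ('s, 't) cmat set"] d_le DIM by auto
  moreover have "\<exists>V W (\<phi> :: ('s, 't) cmat \<Rightarrow> ('s, 't) cmat) \<psi> L.
        open V \<and> p \<in> V \<and> open W \<and> \<phi> ` V = W \<and> \<psi> ` W = V \<and>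
        (\<forall>x\<in>V. \<psi> (\<phi> x) = x) \<and> (\<forall>y\<in>W. \<phi> (\<psi> y) = y) \<and>
        smooth_on V \<phi> \<and> smooth_on W \<psi> \<and>
        subspace L \<and> dim L = ?d \<and> \<phi> ` (?M \<inter> V) = W \<inter> L" if p: "p \<in> ?M" for p
  proof -
    have pr: "p \<in> choi_rank r" using p by (simp add: choi_ext_def)
    obtain I where I: "card I = r" "p \<in> pivotal I" using exists_pivotal[OF pr] by metis
    obtain Op where Op: "open Op" "?M = choi_rank r \<inter> Op"
      using openin_choi_ext[of r] by (auto simp: openin_open)
    define D where "D = frechet_derivative (defining_map I) (at p)"
    have D: "(defining_map I has_derivative D) (at p)"
      unfolding D_def by (rule kdiff_on_Suc_has_derivative[OF open_pivotal kdiff_on_defining_map I(2)])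
    have U: "open (pivotal I \<inter> Op)" "p \<in> pivotal I \<inter> Op"
      using open_pivotal Op I p by auto
    have F: "kdiff_on k (pivotal I \<inter> Op) (defining_map I)" for k
      by (rule kdiff_on_subset[OF kdiff_on_defining_map]) simp
    have S: "defining_map I ` (pivotal I \<inter> Op) \<subseteq> defining_target I"
      using defining_map_in_target[of I] by auto
    have sub: "defining_target I \<subseteq> range D"
      by (rule defining_map_submersion[OF _ I(2) D]) (simp add: pr I(1))
    obtain V W \<phi> \<psi> where *: "open V" "p \<in> V" "V \<subseteq> pivotal I \<inter> Op" "open W"
      "\<phi> ` V = W" "\<psi> ` W = V" "\<And>x. x \<in> V \<Longrightarrow> \<psi> (\<phi> x) = x" "\<And>y. y \<in> W \<Longrightarrow> \<phi> (\<psi> y) = y"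
      "smooth_on V \<phi>" "smooth_on W \<psi>" "\<phi> ` {x \<in> V. defining_map I x = 0} = W \<inter> {x. D x = 0}"
      "dim {x. D x = 0} + dim (defining_target I) = DIM(('s, 't) cmat)"
      by (rule level_set_chart[OF U F subspace_defining_target S D sub], rule that)
    have "defining_map I x = 0 \<longleftrightarrow> x \<in> ?M" if "x \<in> V" for x
      using defining_map_eq_0_iff[of x I] *(3) Op(2) I(1) that by auto
    then have "{x \<in> V. defining_map I x = 0} = ?M \<inter> V" by auto
    moreover have "dim {x. D x = 0} = ?d"
    proof -
      obtain k where k: "n = r + k" using r le_Suc_ex unfolding n_def by blast
      have "card (- I) = k"
        using I(1) k by (simp add: Compl_eq_Diff_UNIV card_Diff_subset n_def)
      then have "dim {x. D x = 0} + (n\<^sup>2 + k\<^sup>2 + CARD('s)\<^sup>2) = 2 * n\<^sup>2"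
        using *(12) unfolding DIM dim_defining_target n_def[symmetric] by simp
      then have "dim {x. D x = 0} + r\<^sup>2 + CARD('s)\<^sup>2 = 2 * n * r"
        by (simp add: k power2_eq_square algebra_simps)
      then have "dim {x. D x = 0} + r\<^sup>2 + CARD('s)\<^sup>2 = 2 * CARD('s) * r * CARD('t)"
        by (simp add: n_def mult_ac)
      \<comment> \<open>The additive equation also shows that the subtraction of natural numbers is
        not truncated once a point \<open>p\<close> exists.\<close>
      from this[symmetric] show ?thesis by simp
    qed
    moreover have "subspace {x. D x = 0}"
      by (rule linear_subspace_kernel[OF has_derivative_linear[OF D]])
    ultimately show ?thesis
      using * by (intro exI[of _ V] exI[of _ W] exI[of _ \<phi>] exI[of _ \<psi>] exI[of _ "{x. D x = 0}"]) simp
  qed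
  ultimately show ?thesis unfolding submanifold_dim_def by blast
qed

text \<open>A perturbation \<open>H\<close> of this \<open>C\<close> is confined to rows and columns
  in \<open>I\<close>. There the partial trace has a single summand, so its vanishing kills every
  entry of \<open>H\<close>.\<close>

lemma choi_ext_nonempty: "(choi_ext CARD('s) :: ('s::finite, 't::finite) cmat set) \<noteq> {}"
proof -
  \<comment> \<open>Any element of the index type of system B would do.\<close>
  define b :: 't where "b = undefined"
  define I :: "('s \<times> 't) set" where "I = UNIV \<times> {b}"
  define c where "c = 1 / real CARD('s)"
  define C :: "('s, 't) cmat" where "C = c *\<^sub>R cproj I"
  have c: "c > 0" by (simp add: c_def)
  have dC: "dag C = C" by (simp add: C_def dag_scaleR)
  have quad: "x \<bullet> (C *v x) = c * ((cproj I *v x) \<bullet> (cproj I *v x))" for x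
    using inner_matrix_vector[of x "cproj I" "cproj I *v x"]
    by (simp add: C_def scaleR_matrix_vector matrix_vector_mul_assoc)
  have psd: "psd C" using dC c by (simp add: psd_iff quad)
  have "ptrace_B C = c *\<^sub>R mat 1"
    by (auto simp: ptrace_B_def C_def cproj_def I_def mat_def vec_eq_iff if_distrib cong: if_cong)
  then have C: "C \<in> choi" using psd by (simp add: choi_iff c_def)
  have pos: "posdef (piv I C)"
    unfolding posdef_def
  proof (intro allI impI)
    fix x :: "complex^('s \<times> 't)" assume x: "x \<noteq> 0"
    have "0 < x \<bullet> (piv I C *v x)" if "cproj I *v x \<noteq> 0"
      using that c unfolding inner_piv quad
      by (intro add_pos_nonneg) (simp_all add: matrix_vector_mul_assoc)
    moreover have "0 < x \<bullet> (piv I C *v x)" if "cproj I *v x = 0"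
      using that x unfolding inner_piv quad by (simp add: matrix_vector_mul_assoc)
    ultimately show "0 < x \<bullet> (piv I C *v x)" by blast
  qed
  have 0: "schur I C = 0"
    unfolding schur_eq_0_iff[OF pos] by (intro exI[of _ "mat 1"]) (simp add: C_def matrix_scalar_ac scalar_matrix_assoc[symmetric])
  have "card I = CARD('s)" by (simp add: I_def card_cartesian_product)
  then have rank: "rank C = CARD('s)" using rank_eq_card_iff[OF pos] 0 by simp
  have "C extreme_point_of choi"
  proof (rule ccontr)
    assume "\<not> C extreme_point_of choi"
    then obtain H where H: "norm H = 1" "dag H = H" "ptrace_B H = 0"
      "H = H ** (matrix_inv (piv I C) ** cproj I ** C)"
      using not_extreme_imp_perturbation[OF C _ pos 0] by metis
    have "matrix_inv (piv I C) ** cproj I ** C ** cproj I = matrix_inv (piv I C) ** cproj I ** C"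
      by (simp add: C_def matrix_scalar_ac scalar_matrix_assoc[symmetric])
    then have HP: "H ** cproj I = H" using H(4) by (metis matrix_mul_assoc)
    have z: "H $ i $ j = 0" if "j \<notin> I" for i j
      using arg_cong[OF HP, of "\<lambda>A. A $ i $ j"] that by (simp add: mult_cproj)
    have z': "H $ i $ j = 0" if "i \<notin> I" for i j
      using arg_cong[OF H(2), of "\<lambda>A. A $ i $ j"] z[OF that, of j] by (simp add: dag_def)
    have "H $ (a, b) $ (a', b) = 0" for a a'
    proof -
      have "0 = (\<Sum>b'\<in>UNIV. H $ (a, b') $ (a', b'))"
        using arg_cong[OF H(3), of "\<lambda>A. A $ a $ a'"] by (simp add: ptrace_B_def)
      also have "\<dots> = (\<Sum>b'\<in>{b}. H $ (a, b') $ (a', b'))"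
        by (rule sum.mono_neutral_right) (auto intro!: z simp: I_def)
      finally show ?thesis by simp
    qed
    then have "H $ i $ j = 0" for i j
      using z[of j i] z'[of i j] by (cases i; cases j) (auto simp: I_def)
    then have "H = 0" by (simp add: vec_eq_iff)
    with H(1) show False by simp
  qed
  then have "C \<in> choi_ext CARD('s)" using C rank by (simp add: choi_ext_def choi_rank_def)
  then show ?thesis by blast
qed

theorem theorem4:
  fixes r :: nat
  shows "(CARD('s::finite) \<le> r * CARD('t::finite) \<and> r \<le> CARD('s) * CARD('t) \<longrightarrow>
           openin (top_of_set (choi_rank r :: ('s, 't) cmat set)) (choi_ext r) \<and>
           submanifold_dim (choi_ext r :: ('s, 't) cmat set)
             (2 * CARD('s) * r * CARD('t) - r ^ 2 - CARD('s) ^ 2))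
         \<and> (choi_ext CARD('s) :: ('s, 't) cmat set) \<noteq> {}"
  using openin_choi_ext submanifold_dim_choi_ext choi_ext_nonempty by blast

end
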